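(* Let $\mathcal L$ be a first-order language containing a binary relation symbol $<$, and let $T$ be an $\mathcal L$-theory extending the theory of infinite linear orderings (with $<$ interpreted as the ordering). Suppose $T$ is weakly o-minimal. Then $T$ has the $\mathrm{VC}1$ property, and consequently, for every model $\mathbf M$ of $T$ and every finite set $\Delta(x;y)$ of partitioned $\mathcal L$-formulas, the dual VC density of $\Delta$ in $\mathbf M$ is at most $|x|$.
   Context: $T$ is weakly o-minimal if in every model $\mathbf M\models T$, every subset of $M$ definable with parameters is a finite union of convex subsets of $M$. For a structure $\mathbf M$, a finite set $\Delta(x;y)$ of partitioned formulas and a finite $B\subseteq M^{|y|}$, let $S^\Delta(B)$ be the set of all $\Delta$-types $\mathrm{tp}^\Delta(a/B)=\{\varphi(x;b):\varphi\in\Delta,b\in B,\mathbf M\models\varphi(a;b)\}\cup\{\neg\varphi(x;b):\varphi\in\Delta,b\in B,\mathbf M\not\models\varphi(a;b)\}$ for $a\in M^{|x|}$. Put $\pi^*_\Delta(t)=\max\{|S^\Delta(B)|: B\subseteq M^{|y|},|B|=t\}$; the dual VC density of $\Delta$ is $\inf\{r\ge0:\pi^*_\Delta(t)=O(t^r)\}$. A uniform definition of $\Delta(x;B)$-types over finite sets with $d$ parameters is a finite family $(\mathcal F_i)_{i\in I}$, $\mathcal F_i=(\varphi_i(y;y_1,\dots,y_d))_{\varphi\in\Delta}$ of $\mathcal L$-formulas with $|y_j|=|y|$, such that for every finite $B\subseteq M^{|y|}$ and every $q\in S^\Delta(B)$ there are $b_1,\dots,b_d\in B$ and $i\in I$ with: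 for all $\varphi\in\Delta$ and $b\in B$, $\varphi(x;b)\in q$ iff $\mathbf M\models\varphi_i(b;b_1,\dots,b_d)$. A structure $\mathbf M$ has the $\mathrm{VC}d$ property if every finite nonempty set $\Delta(x;y)$ of partitioned formulas with $|x|=1$ has a uniform definition of $\Delta(x;B)$-types over finite sets with $d$ parameters; a theory has the $\mathrm{VC}d$ property if all its models do.
   Formalization: In the uniform definition of types the finite set B is taken nonempty (for B empty no parameter b_1 in B exists, so VC1 would always fail); models are taken with universe inside an arbitrary ambient set at least as large as the set of formulas, which covers every model up to isomorphism. *)

theory Defs
  imports "HOL-Library.Landau_Symbols" "HOL-Library.Extended_Real" "HOL-Library.Equipollence"
begin

section \<open>First-order logic\<close>

record ('f, 'r) language =
  funs :: "'f set"
  rels :: "'r set"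
  farity :: "'f \<Rightarrow> nat"
  rarity :: "'r \<Rightarrow> nat"

datatype 'f tm = Var nat | Fun 'f "'f tm list"

datatype ('f, 'r) fm =
    Eq "'f tm" "'f tm"
  | Rel 'r "'f tm list"
  | Neg "('f, 'r) fm"
  | And "('f, 'r) fm" "('f, 'r) fm"
  | Ex nat "('f, 'r) fm"

fun is_term :: "('f, 'r) language \<Rightarrow> 'f tm \<Rightarrow> bool" where
  "is_term L (Var v) \<longleftrightarrow> True"
| "is_term L (Fun f ts) \<longleftrightarrow> f \<in> funs L \<and> length ts = farity L f \<and> (\<forall>t\<in>set ts. is_term L t)"

fun is_formula :: "('f, 'r) language \<Rightarrow> ('f, 'r) fm \<Rightarrow> bool" where
  "is_formula L (Eq s t) \<longleftrightarrow> is_term L s \<and> is_term L t"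
| "is_formula L (Rel R ts) \<longleftrightarrow> R \<in> rels L \<and> length ts = rarity L R \<and> (\<forall>t\<in>set ts. is_term L t)"
| "is_formula L (Neg \<phi>) \<longleftrightarrow> is_formula L \<phi>"
| "is_formula L (And \<phi> \<psi>) \<longleftrightarrow> is_formula L \<phi> \<and> is_formula L \<psi>"
| "is_formula L (Ex v \<phi>) \<longleftrightarrow> is_formula L \<phi>"

fun tm_vars :: "'f tm \<Rightarrow> nat set" where
  "tm_vars (Var v) = {v}"
| "tm_vars (Fun f ts) = (\<Union>t\<in>set ts. tm_vars t)"

fun fv :: "('f, 'r) fm \<Rightarrow> nat set" where
  "fv (Eq s t) = tm_vars s \<union> tm_vars t"
| "fv (Rel R ts) = (\<Union>t\<in>set ts. tm_vars t)"
| "fv (Neg \<phi>) = fv \<phi>"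
| "fv (And \<phi> \<psi>) = fv \<phi> \<union> fv \<psi>"
| "fv (Ex v \<phi>) = fv \<phi> - {v}"

definition is_sentence :: "('f, 'r) language \<Rightarrow> ('f, 'r) fm \<Rightarrow> bool" where
  "is_sentence L \<phi> \<longleftrightarrow> is_formula L \<phi> \<and> fv \<phi> = {}"

record ('m, 'f, 'r) struct =
  univ :: "'m set"
  ifun :: "'f \<Rightarrow> 'm list \<Rightarrow> 'm"
  irel :: "'r \<Rightarrow> 'm list \<Rightarrow> bool"

definition tuples :: "('m, 'f, 'r) struct \<Rightarrow> nat \<Rightarrow> 'm list set" where
  "tuples M n = {as. length as = n \<and> set as \<subseteq> univ M}"

definition is_struct :: "('f, 'r) language \<Rightarrow> ('m, 'f, 'r) struct \<Rightarrow> bool" where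
  "is_struct L M \<longleftrightarrow>
     univ M \<noteq> {} \<and> (\<forall>f\<in>funs L. \<forall>as\<in>tuples M (farity L f). ifun M f as \<in> univ M)"

fun eval :: "('m, 'f, 'r) struct \<Rightarrow> (nat \<Rightarrow> 'm) \<Rightarrow> 'f tm \<Rightarrow> 'm" where
  "eval M e (Var v) = e v"
| "eval M e (Fun f ts) = ifun M f (map (eval M e) ts)"

fun sat :: "('m, 'f, 'r) struct \<Rightarrow> (nat \<Rightarrow> 'm) \<Rightarrow> ('f, 'r) fm \<Rightarrow> bool" where
  "sat M e (Eq s t) \<longleftrightarrow> eval M e s = eval M e t"
| "sat M e (Rel R ts) \<longleftrightarrow> irel M R (map (eval M e) ts)"
| "sat M e (Neg \<phi>) \<longleftrightarrow> \<not> sat M e \<phi>"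
| "sat M e (And \<phi> \<psi>) \<longleftrightarrow> sat M e \<phi> \<and> sat M e \<psi>"
| "sat M e (Ex v \<phi>) \<longleftrightarrow> (\<exists>a\<in>univ M. sat M (e(v := a)) \<phi>)"

lemma eval_cong: "(\<And>v. v \<in> tm_vars t \<Longrightarrow> e v = e' v) \<Longrightarrow> eval M e t = eval M e' t"
proof (induction t)
  case (Fun f ts)
  have "eval M e t = eval M e' t" if "t \<in> set ts" for t
    using that Fun.prems by (intro Fun.IH) auto
  then have "map (eval M e) ts = map (eval M e') ts" by simp
  then show ?case by (simp del: map_eq_conv)
qed simp

lemma sat_cong: "(\<And>v. v \<in> fv \<phi> \<Longrightarrow> e v = e' v) \<Longrightarrow> sat M e \<phi> = sat M e' \<phi>"
proof (induction \<phi> arbitrary: e e')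
  case (Eq s t)
  then show ?case using eval_cong[of s e e' M] eval_cong[of t e e' M] by auto
next
  case (Rel R ts)
  then have "map (eval M e) ts = map (eval M e') ts"
    by (auto intro!: eval_cong)
  then show ?case by (simp del: map_eq_conv)
next
  case (Neg \<phi>)
  then show ?case by (metis fv.simps(3) sat.simps(3))
next
  case (And \<phi> \<psi>)
  then show ?case by (metis UnCI fv.simps(4) sat.simps(4))
next
  case (Ex v \<phi>)
  have "sat M (e(v := a)) \<phi> = sat M (e'(v := a)) \<phi>" for a
    using Ex.prems by (intro Ex.IH) auto
  then show ?case by simp
qed

text \<open>\<open>sat_at M xs as \<phi>\<close> is \<open>M \<Turnstile> \<phi>(as)\<close> for a formula \<open>\<phi>(xs)\<close> whose free variables are among
  the distinct variables \<open>xs\<close>; the value given to the other variables is irrelevant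
  by \<open>sat_cong\<close>.\<close>

definition assign :: "nat list \<Rightarrow> 'm list \<Rightarrow> nat \<Rightarrow> 'm" where
  "assign xs as v = (case map_of (zip xs as) v of Some a \<Rightarrow> a | None \<Rightarrow> undefined)"

definition sat_at :: "('m, 'f, 'r) struct \<Rightarrow> nat list \<Rightarrow> 'm list \<Rightarrow> ('f, 'r) fm \<Rightarrow> bool" where
  "sat_at M xs as \<phi> \<longleftrightarrow> sat M (assign xs as) \<phi>"

definition is_formula_in :: "('f, 'r) language \<Rightarrow> nat list \<Rightarrow> ('f, 'r) fm \<Rightarrow> bool" where
  "is_formula_in L xs \<phi> \<longleftrightarrow> is_formula L \<phi> \<and> distinct xs \<and> fv \<phi> \<subseteq> set xs"

text \<open>HOL cannot quantify over types inside a formula, so \<open>every model\<close> means every model whose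
  universe is a subset of an ambient type \<open>'m\<close>, which is a parameter of all notions about
  theories. If \<open>'m\<close> is at least as large as the set of \<open>L\<close>-formulas, then by
  downward Loewenheim-Skolem neither entailment nor weak o-minimality depends on \<open>'m\<close>; as \<open>'m\<close>
  is otherwise arbitrary, models of every cardinality are covered.\<close>

definition models :: "('f, 'r) language \<Rightarrow> ('f, 'r) fm set \<Rightarrow> ('m, 'f, 'r) struct set" where
  "models L T =
     {M. is_struct L M \<and> (\<forall>\<sigma>\<in>T. \<forall>e. (\<forall>v. e v \<in> univ M) \<longrightarrow> sat M e \<sigma>)}"

section \<open>Infinite linear orderings\<close>

abbreviation less_fm :: "'r \<Rightarrow> nat \<Rightarrow> nat \<Rightarrow> ('f, 'r) fm" where
  "less_fm lt v w \<equiv> Rel lt [Var v, Var w]"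

definition Truth :: "('f, 'r) fm" where
  "Truth = Neg (Ex 0 (Neg (Eq (Var 0) (Var 0))))"

definition irrefl_ax :: "'r \<Rightarrow> ('f, 'r) fm" where
  "irrefl_ax lt = Neg (Ex 0 (less_fm lt 0 0))"

definition trans_ax :: "'r \<Rightarrow> ('f, 'r) fm" where
  "trans_ax lt =
     Neg (Ex 0 (Ex 1 (Ex 2 (And (And (less_fm lt 0 1) (less_fm lt 1 2)) (Neg (less_fm lt 0 2))))))"

definition total_ax :: "'r \<Rightarrow> ('f, 'r) fm" where
  "total_ax lt =
     Neg (Ex 0 (Ex 1 (And (Neg (Eq (Var 0) (Var 1)))
       (And (Neg (less_fm lt 0 1)) (Neg (less_fm lt 1 0))))))"

definition at_least_ax :: "nat \<Rightarrow> ('f, 'r) fm" where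
  "at_least_ax n =
     foldr Ex [0..<n]
       (foldr And (concat (map (\<lambda>j. map (\<lambda>i. Neg (Eq (Var i) (Var j))) [0..<j]) [0..<n])) Truth)"

definition inf_lin_ord :: "'r \<Rightarrow> ('f, 'r) fm set" where
  "inf_lin_ord lt = {irrefl_ax lt, trans_ax lt, total_ax lt} \<union> range at_least_ax"

abbreviation less_in :: "('m, 'f, 'r) struct \<Rightarrow> 'r \<Rightarrow> 'm \<Rightarrow> 'm \<Rightarrow> bool" where
  "less_in M lt a b \<equiv> irel M lt [a, b]"

lemma sat_foldr_Ex:
  "sat M e (foldr Ex xs \<phi>) \<longleftrightarrow>
     (\<exists>e'. (\<forall>v\<in>set xs. e' v \<in> univ M) \<and> (\<forall>v. v \<notin> set xs \<longrightarrow> e' v = e v) \<and> sat M e' \<phi>)"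
proof (induction xs arbitrary: e)
  case Nil
  have "e' = e" if "\<forall>v. e' v = e v" for e'
    using that by auto
  then show ?case by auto
next
  case (Cons x xs)
  show ?case (is "?L \<longleftrightarrow> ?R")
  proof
    assume ?L
    then obtain a where a: "a \<in> univ M" "sat M (e(x := a)) (foldr Ex xs \<phi>)" by auto
    then obtain e' where e': "\<forall>v\<in>set xs. e' v \<in> univ M" "\<forall>v. v \<notin> set xs \<longrightarrow> e' v = (e(x := a)) v"
      "sat M e' \<phi>"
      using Cons.IH by blast
    have "e' x \<in> univ M" using a e' by (cases "x \<in> set xs") auto
    with e' show ?R by (intro exI[of _ e']) auto
  next
    assume ?R
    then obtain e' where e': "\<forall>v\<in>set (x # xs). e' v \<in> univ M"
      "\<forall>v. v \<notin> set (x # xs) \<longrightarrow> e' v = e v" "sat M e' \<phi>" by blast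
    then have "sat M (e(x := e' x)) (foldr Ex xs \<phi>)"
      unfolding Cons.IH by (intro exI[of _ e']) auto
    with e' show ?L by auto
  qed
qed

lemma sat_foldr_And: "sat M e (foldr And \<phi>s \<psi>) \<longleftrightarrow> (\<forall>\<phi>\<in>set \<phi>s. sat M e \<phi>) \<and> sat M e \<psi>"
  by (induction \<phi>s) auto

lemma sat_at_least_ax:
  "sat M e (at_least_ax n) \<longleftrightarrow> (\<exists>g. inj_on g {..<n} \<and> g ` {..<n} \<subseteq> univ M)"
  (is "?L \<longleftrightarrow> ?R")
proof -
  have conj: "sat M e' (foldr And (concat (map (\<lambda>j. map (\<lambda>i. Neg (Eq (Var i) (Var j))) [0..<j]) [0..<n])) Truth)
      \<longleftrightarrow> inj_on e' {..<n}" for e'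
  proof -
    have "(\<forall>j<n. \<forall>i<j. e' i \<noteq> e' j) \<longleftrightarrow> inj_on e' {..<n}"
      by (auto simp: inj_on_def) (metis less_trans nat_neq_iff)
    then show ?thesis
      by (auto simp: sat_foldr_And Truth_def)
  qed
  show ?thesis
  proof
    assume ?L
    then show ?R unfolding at_least_ax_def sat_foldr_Ex conj by auto
  next
    assume ?R
    then obtain g where g: "inj_on g {..<n}" "g ` {..<n} \<subseteq> univ M" by blast
    let ?e = "\<lambda>v. if v < n then g v else e v"
    have "inj_on ?e {..<n}" using g(1) by (auto simp: inj_on_def)
    then show ?L
      unfolding at_least_ax_def sat_foldr_Ex conj using g(2) by (intro exI[of _ ?e]) auto
  qed
qed

lemma models_inf_lin_ord:
  "M \<in> models L (inf_lin_ord lt) \<longleftrightarrow>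
     is_struct L M \<and> infinite (univ M) \<and>
     (\<forall>a\<in>univ M. \<not> less_in M lt a a) \<and>
     (\<forall>a\<in>univ M. \<forall>b\<in>univ M. \<forall>c\<in>univ M. less_in M lt a b \<longrightarrow> less_in M lt b c \<longrightarrow> less_in M lt a c) \<and>
     (\<forall>a\<in>univ M. \<forall>b\<in>univ M. less_in M lt a b \<or> a = b \<or> less_in M lt b a)"
proof -
  have inf: "(\<forall>n. \<exists>g. inj_on g {..<n::nat} \<and> g ` {..<n} \<subseteq> univ M) \<longleftrightarrow> infinite (univ M)"
  proof
    assume *: "\<forall>n. \<exists>g. inj_on g {..<n::nat} \<and> g ` {..<n} \<subseteq> univ M"
    show "infinite (univ M)"
    proof
      assume fin: "finite (univ M)"
      obtain g where "inj_on g {..<Suc (card (univ M))}" "g ` {..<Suc (card (univ M))} \<subseteq> univ M"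
        using * by blast
      then show False using card_inj_on_le[OF _ _ fin] by fastforce
    qed
  next
    assume "infinite (univ M)"
    then obtain g :: "nat \<Rightarrow> _" where "inj g" "range g \<subseteq> univ M"
      using infinite_countable_subset by blast
    then show "\<forall>n. \<exists>g. inj_on g {..<n::nat} \<and> g ` {..<n} \<subseteq> univ M"
      by (meson image_mono inj_on_subset order_trans subset_UNIV)
  qed
  have ex: "\<exists>e::nat \<Rightarrow> _. \<forall>v. e v \<in> univ M" if st: "is_struct L M"
  proof -
    obtain a where "a \<in> univ M" using st unfolding is_struct_def by blast
    then show ?thesis by (intro exI[of _ "\<lambda>_. a"]) simp
  qed
  let ?lin = "(\<forall>a\<in>univ M. \<not> less_in M lt a a) \<and>
     (\<forall>a\<in>univ M. \<forall>b\<in>univ M. \<forall>c\<in>univ M. less_in M lt a b \<longrightarrow> less_in M lt b c \<longrightarrow> less_in M lt a c) \<and>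
     (\<forall>a\<in>univ M. \<forall>b\<in>univ M. less_in M lt a b \<or> a = b \<or> less_in M lt b a)"
  have 1: "sat M e (irrefl_ax lt) \<longleftrightarrow> (\<forall>a\<in>univ M. \<not> less_in M lt a a)" for e
    by (simp add: irrefl_ax_def)
  have 2: "sat M e (trans_ax lt) \<longleftrightarrow> (\<forall>a\<in>univ M. \<forall>b\<in>univ M. \<forall>c\<in>univ M.
      less_in M lt a b \<longrightarrow> less_in M lt b c \<longrightarrow> less_in M lt a c)" for e
    by (simp add: trans_ax_def)
  have 3: "sat M e (total_ax lt) \<longleftrightarrow>
      (\<forall>a\<in>univ M. \<forall>b\<in>univ M. less_in M lt a b \<or> a = b \<or> less_in M lt b a)" for e
    by (simp add: total_ax_def) blast
  have all: "(\<forall>\<sigma>\<in>inf_lin_ord lt. sat M e \<sigma>) \<longleftrightarrow> infinite (univ M) \<and> ?lin" for e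
    unfolding inf_lin_ord_def ball_Un ball_simps 1 2 3 sat_at_least_ax inf by blast
  have "(\<forall>\<sigma>\<in>inf_lin_ord lt. \<forall>e. (\<forall>v. e v \<in> univ M) \<longrightarrow> sat M e \<sigma>) \<longleftrightarrow>
      (\<forall>e. (\<forall>v. e v \<in> univ M) \<longrightarrow> (\<forall>\<sigma>\<in>inf_lin_ord lt. sat M e \<sigma>))" by blast
  then have "M \<in> models L (inf_lin_ord lt) \<longleftrightarrow>
      is_struct L M \<and> ((\<exists>e::nat \<Rightarrow> _. \<forall>v. e v \<in> univ M) \<longrightarrow> infinite (univ M) \<and> ?lin)"
    unfolding models_def all by simp
  with ex show ?thesis by argo
qed

section \<open>Weak o-minimality\<close>

definition definable :: "('f, 'r) language \<Rightarrow> ('m, 'f, 'r) struct \<Rightarrow> 'm set \<Rightarrow> bool" where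
  "definable L M D \<longleftrightarrow>
     (\<exists>x ys \<phi>. is_formula_in L (x # ys) \<phi> \<and>
       (\<exists>bs\<in>tuples M (length ys). D = {a \<in> univ M. sat_at M (x # ys) (a # bs) \<phi>}))"

definition convex_in :: "('m, 'f, 'r) struct \<Rightarrow> 'r \<Rightarrow> 'm set \<Rightarrow> bool" where
  "convex_in M lt C \<longleftrightarrow>
     C \<subseteq> univ M \<and>
     (\<forall>a\<in>C. \<forall>b\<in>C. \<forall>c\<in>univ M. less_in M lt a c \<and> less_in M lt c b \<longrightarrow> c \<in> C)"

definition weakly_o_minimal ::
    "'m itself \<Rightarrow> ('f, 'r) language \<Rightarrow> 'r \<Rightarrow> ('f, 'r) fm set \<Rightarrow> bool" where
  "weakly_o_minimal _ L lt T \<longleftrightarrow>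
     (\<forall>M \<in> (models L T :: ('m, 'f, 'r) struct set). \<forall>D. definable L M D \<longrightarrow>
       (\<exists>\<C>. finite \<C> \<and> (\<forall>C\<in>\<C>. convex_in M lt C) \<and> D = \<Union>\<C>))"

section \<open>Types over finite sets and dual VC density\<close>

definition is_partitioned ::
    "('f, 'r) language \<Rightarrow> nat list \<Rightarrow> nat list \<Rightarrow> ('f, 'r) fm set \<Rightarrow> bool" where
  "is_partitioned L x y \<Delta> \<longleftrightarrow> distinct (x @ y) \<and> (\<forall>\<phi>\<in>\<Delta>. is_formula_in L (x @ y) \<phi>)"

text \<open>The pair \<open>(\<phi>, b)\<close> stands for the formula \<open>\<phi>(x;b)\<close> with parameters.\<close>

definition tp :: "('m, 'f, 'r) struct \<Rightarrow> nat list \<Rightarrow> nat list \<Rightarrow> ('f, 'r) fm set \<Rightarrow>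
    'm list \<Rightarrow> 'm list set \<Rightarrow> (('f, 'r) fm \<times> 'm list) set" where
  "tp M x y \<Delta> a B =
     {(\<phi>, b) | \<phi> b. \<phi> \<in> \<Delta> \<and> b \<in> B \<and> sat_at M (x @ y) (a @ b) \<phi>} \<union>
     {(Neg \<phi>, b) | \<phi> b. \<phi> \<in> \<Delta> \<and> b \<in> B \<and> \<not> sat_at M (x @ y) (a @ b) \<phi>}"

definition type_space :: "('m, 'f, 'r) struct \<Rightarrow> nat list \<Rightarrow> nat list \<Rightarrow> ('f, 'r) fm set \<Rightarrow>
    'm list set \<Rightarrow> (('f, 'r) fm \<times> 'm list) set set" where
  "type_space M x y \<Delta> B = {tp M x y \<Delta> a B | a. a \<in> tuples M (length x)}"

text \<open>On \<^typ>\<open>nat\<close>, \<^const>\<open>Sup\<close> is the maximum of a nonempty finite set, and 0 for the empty set;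
  the latter only occurs if there is no \<open>B\<close> with \<open>t\<close> elements.\<close>

definition dual_shatter :: "('m, 'f, 'r) struct \<Rightarrow> nat list \<Rightarrow> nat list \<Rightarrow> ('f, 'r) fm set \<Rightarrow>
    nat \<Rightarrow> nat" where
  "dual_shatter M x y \<Delta> t =
     Sup {card (type_space M x y \<Delta> B) | B. B \<subseteq> tuples M (length y) \<and> finite B \<and> card B = t}"

text \<open>The infimum is taken in \<^typ>\<open>ereal\<close>, so it is infinite if no exponent exists.\<close>

definition dual_vc_density :: "('m, 'f, 'r) struct \<Rightarrow> nat list \<Rightarrow> nat list \<Rightarrow> ('f, 'r) fm set \<Rightarrow>
    ereal" where
  "dual_vc_density M x y \<Delta> =
     Inf {ereal r | r. r \<ge> 0 \<and>
       (\<lambda>t. real (dual_shatter M x y \<Delta> t)) \<in> O(\<lambda>t. real t powr r)}"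

section \<open>The VC\<open>d\<close> property\<close>

text \<open>\<open>F i \<phi>\<close> is the formula \<open>\<phi>\<^sub>i(y; y\<^sub>1, \<dots>, y\<^sub>d)\<close>, with index set \<open>{..<k}\<close> and \<open>ys\<close> the list of the
  tuples \<open>y\<^sub>j\<close>. The set \<open>B\<close> has to be nonempty: for \<open>d \<ge> 1\<close> there is no choice of
  parameters from the empty set, although there is a type over it.\<close>

definition has_uniform_definition :: "('f, 'r) language \<Rightarrow> ('m, 'f, 'r) struct \<Rightarrow> nat \<Rightarrow>
    nat list \<Rightarrow> nat list \<Rightarrow> ('f, 'r) fm set \<Rightarrow> bool" where
  "has_uniform_definition L M d x y \<Delta> \<longleftrightarrow>
     (\<exists>(k::nat) (F :: nat \<Rightarrow> ('f, 'r) fm \<Rightarrow> ('f, 'r) fm) ys.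
        length ys = d \<and> (\<forall>z\<in>set ys. length z = length y) \<and> distinct (y @ concat ys) \<and>
        (\<forall>i<k. \<forall>\<phi>\<in>\<Delta>. is_formula_in L (y @ concat ys) (F i \<phi>)) \<and>
        (\<forall>B q. finite B \<and> B \<noteq> {} \<and> B \<subseteq> tuples M (length y) \<and> q \<in> type_space M x y \<Delta> B \<longrightarrow>
          (\<exists>bs i. length bs = d \<and> set bs \<subseteq> B \<and> i < k \<and>
            (\<forall>\<phi>\<in>\<Delta>. \<forall>b\<in>B. (\<phi>, b) \<in> q \<longleftrightarrow>
              sat_at M (y @ concat ys) (b @ concat bs) (F i \<phi>)))))"

definition VC_struct :: "('f, 'r) language \<Rightarrow> ('m, 'f, 'r) struct \<Rightarrow> nat \<Rightarrow> bool" where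
  "VC_struct L M d \<longleftrightarrow>
     (\<forall>x y \<Delta>. is_partitioned L x y \<Delta> \<and> length x = 1 \<and> finite \<Delta> \<and> \<Delta> \<noteq> {} \<longrightarrow>
        has_uniform_definition L M d x y \<Delta>)"

definition VC_theory :: "'m itself \<Rightarrow> ('f, 'r) language \<Rightarrow> ('f, 'r) fm set \<Rightarrow> nat \<Rightarrow> bool" where
  "VC_theory _ L T d \<longleftrightarrow> (\<forall>M \<in> (models L T :: ('m, 'f, 'r) struct set). VC_struct L M d)"

end

theory Submission
  imports Defs
begin

text \<open>By compactness, weak o-minimality bounds the number of truth value changes of \<open>\<phi>(x;b)\<close> along
  the ordering uniformly in \<open>b\<close>: otherwise the Skolem hull, inside an ultrapower, of suitable
  parameters and of the points where the truth value changes is a model of \<open>T\<close> with a definable set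
  that is not a finite union of convex sets; the hull is small enough to live on the ambient type.
  Hence \<open>\<phi>(x;b)\<close> is a Boolean combination of uniformly definable final segments. A type over a
  finite \<open>B\<close> is determined by the least of these segments that contains the realization, and
  inclusion of segments is definable, so that one parameter from \<open>B\<close> suffices. For several
  variables, let \<open>a\<^sub>0\<close> be the first coordinate of a tuple and \<open>a\<close> the others. The type of \<open>a\<^sub>0\<close>
  over \<open>{a} \<times> B\<close> is defined by a formula with parameters \<open>a\<close> and some \<open>b' \<in> B\<close>, which leaves the
  type of \<open>a\<close> over \<open>B \<times> {b'}\<close>; by induction there are \<open>O(|B|^|x|)\<close> types.\<close>

section \<open>Ultrapowers of Skolem hulls\<close>

definition ultrafilter :: "'a filter \<Rightarrow> bool" where
  "ultrafilter U \<longleftrightarrow> U \<noteq> bot \<and> (\<forall>P. eventually P U \<or> eventually (\<lambda>x. \<not> P x) U)"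

lemma ultrafilter_not_iff:
  "ultrafilter U \<Longrightarrow> eventually (\<lambda>x. \<not> P x) U \<longleftrightarrow> \<not> eventually P U"
  unfolding ultrafilter_def using eventually_elim2[of P U "\<lambda>x. \<not> P x" "\<lambda>_. False"]
  by (auto simp: trivial_limit_def)

text \<open>Zorn's lemma on the proper filters below \<open>F\<close>, ordered so that finer filters
  are larger. A maximal one decides every predicate: if it does not make the complement of
  \<open>P\<close> eventually true, then adjoining \<open>P\<close> keeps it proper and hence
  changes nothing.\<close>

lemma ex_ultrafilter_le:
  assumes "F \<noteq> bot"
  shows "\<exists>U\<le>F. ultrafilter U"
proof -
  let ?A = "{G. G \<noteq> bot \<and> G \<le> F}"
  let ?R = "\<lambda>G G'. G' \<le> G"
  have "\<exists>m\<in>?A. \<forall>a\<in>?A. ?R m a \<longrightarrow> a = m"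
  proof (rule predicate_Zorn)
    show "partial_order_on ?A (relation_of ?R ?A)"
      by (rule partial_order_on_relation_ofI) auto
    fix C assume C: "C \<in> Chains (relation_of ?R ?A)"
    show "\<exists>u\<in>?A. \<forall>a\<in>C. ?R a u"
    proof (cases "C = {}")
      case True
      then show ?thesis using assms by blast
    next
      case False
      have sub: "C \<subseteq> ?A" using C unfolding Chains_def relation_of_def by auto
      have tot: "G \<le> G' \<or> G' \<le> G" if "G \<in> C" "G' \<in> C" for G G'
        using C that unfolding Chains_def relation_of_def by auto
      \<comment> \<open>The infimum of two members of a chain is one of them, so \<open>C\<close> is
        a base of \<open>Inf C\<close>: what holds eventually for \<open>Inf C\<close> already does
        so for a single member.\<close>
      have "\<exists>x\<in>C. x \<le> inf G G'" if "G \<in> C" "G' \<in> C" for G G'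
        using tot[OF that] that by (metis inf.absorb1 inf.absorb2 order_refl)
      then have "eventually (\<lambda>_. False) (Inf C) \<longleftrightarrow> (\<exists>b\<in>C. eventually (\<lambda>_. False) b)"
        by (intro eventually_Inf_base False)
      then have "Inf C \<noteq> bot" using sub by (auto simp: trivial_limit_def)
      moreover have "Inf C \<le> F" using False sub by (auto intro: Inf_lower2)
      ultimately show ?thesis by (auto intro: Inf_lower)
    qed
  qed
  then obtain U where U: "U \<noteq> bot" "U \<le> F" "\<And>G. G \<noteq> bot \<Longrightarrow> G \<le> U \<Longrightarrow> G = U"
    by (auto intro: order_trans)
  have "eventually P U" if "\<not> eventually (\<lambda>x. \<not> P x) U" for P
  proof -
    have "inf U (principal {x. P x}) \<noteq> bot"
      using that by (simp add: trivial_limit_def eventually_inf_principal)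
    then have "inf U (principal {x. P x}) = U" by (intro U(3)) auto
    moreover have "eventually P (inf U (principal {x. P x}))"
      by (simp add: eventually_inf_principal)
    ultimately show ?thesis by simp
  qed
  then have "ultrafilter U" using U(1) unfolding ultrafilter_def by blast
  with U(2) show ?thesis by blast
qed

section \<open>Los's theorem for a Skolem closed set of sequences\<close>

lemma finite_tm_vars: "finite (tm_vars t)"
  by (induction t) auto

lemma finite_fv: "finite (fv \<phi>)"
  by (induction \<phi>) (auto simp: finite_tm_vars)

text \<open>A subset \<open>H\<close> of the power of \<open>M\<close> that is closed under pointwise Skolem functions satisfies
  the theorem of Los modulo \<open>U\<close>. The map \<open>q\<close> realizes the quotient inside the type of \<open>M\<close>.\<close>

locale skolem_ultrapower =
  fixes L :: "('f, 'r) language" and M :: "('m, 'f, 'r) struct" and U :: "'i filter"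
    and H :: "('i \<Rightarrow> 'm) set" and q :: "('i \<Rightarrow> 'm) \<Rightarrow> 'm"
  assumes ultra: "ultrafilter U"
    and H_nonempty: "H \<noteq> {}"
    and H_univ: "h \<in> H \<Longrightarrow> h n \<in> univ M"
    and skolem: "is_formula L \<phi> \<Longrightarrow> (\<And>w. e w \<in> H) \<Longrightarrow>
      \<exists>h\<in>H. \<forall>n. (\<exists>a\<in>univ M. sat M ((\<lambda>w. e w n)(v := a)) \<phi>) \<longrightarrow>
        sat M ((\<lambda>w. e w n)(v := h n)) \<phi>"
    and q_eq_iff: "h \<in> H \<Longrightarrow> h' \<in> H \<Longrightarrow> q h = q h' \<longleftrightarrow> (\<forall>\<^sub>F n in U. h n = h' n)"
    and str: "is_struct L M"
begin

definition rep :: "'m \<Rightarrow> 'i \<Rightarrow> 'm" where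
  "rep = inv_into H q"

definition N :: "('m, 'f, 'r) struct" where
  "N = \<lparr>univ = q ` H,
        ifun = (\<lambda>f as. q (\<lambda>n. ifun M f (map (\<lambda>a. rep a n) as))),
        irel = (\<lambda>R as. \<forall>\<^sub>F n in U. irel M R (map (\<lambda>a. rep a n) as))\<rparr>"

lemma rep_in: "a \<in> q ` H \<Longrightarrow> rep a \<in> H"
  by (simp add: rep_def inv_into_into)

lemma q_rep: "a \<in> q ` H \<Longrightarrow> q (rep a) = a"
  by (simp add: rep_def f_inv_into_f)

lemma rep_q: "h \<in> H \<Longrightarrow> \<forall>\<^sub>F n in U. rep (q h) n = h n"
  using q_eq_iff[of "rep (q h)" h] by (simp add: q_rep rep_in)

text \<open>The value of \<open>f\<close> is the only witness of the formula saying that a variable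
  equals the term, so the Skolem function of this formula is pointwise application of
  \<open>f\<close>. Variables below \<open>?k\<close> hold the arguments, variable \<open>?k\<close>
  the value, and \<open>h0\<close> fills the rest.\<close>

lemma fun_closed:
  assumes f: "f \<in> funs L" and hs: "set hs \<subseteq> H" "length hs = farity L f"
  shows "(\<lambda>n. ifun M f (map (\<lambda>h. h n) hs)) \<in> H"
proof -
  obtain h0 where h0: "h0 \<in> H" using H_nonempty by blast
  let ?k = "length hs"
  let ?e = "\<lambda>w. if w < ?k then hs ! w else h0"
  let ?\<phi> = "Eq (Var ?k) (Fun f (map Var [0..<?k])) :: ('f, 'r) fm"
  have "is_formula L ?\<phi>" using f hs by simp
  moreover have "?e w \<in> H" for w using h0 hs by (auto simp: subset_iff)
  ultimately obtain h where h: "h \<in> H"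
    "\<And>n. (\<exists>a\<in>univ M. sat M ((\<lambda>w. ?e w n)(?k := a)) ?\<phi>) \<Longrightarrow>
        sat M ((\<lambda>w. ?e w n)(?k := h n)) ?\<phi>"
    using skolem[of ?\<phi> ?e ?k] by blast
  have ev: "map (eval M ((\<lambda>w. ?e w n)(?k := a))) (map Var [0..<?k]) = map (\<lambda>h. h n) hs" for n a
    by (rule nth_equalityI) auto
  have "ifun M f (map (\<lambda>h. h n) hs) \<in> univ M" for n
  proof -
    have "map (\<lambda>h. h n) hs \<in> tuples M (farity L f)"
      using hs H_univ by (auto simp: tuples_def)
    with str f show ?thesis unfolding is_struct_def by blast
  qed
  then have "h n = ifun M f (map (\<lambda>h. h n) hs)" for n
    using h(2)[of n] by (simp add: ev del: map_map)
  then have "h = (\<lambda>n. ifun M f (map (\<lambda>h. h n) hs))" by blast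
  with h(1) show ?thesis by simp
qed

text \<open>A representative agrees with the original sequence only modulo \<open>U\<close>;
  finitely many such agreements hold simultaneously.\<close>

lemma eventually_rep_q_map:
  "g ` set ts \<subseteq> H \<Longrightarrow> \<forall>\<^sub>F n in U. map (\<lambda>t. rep (q (g t)) n) ts = map (\<lambda>t. g t n) ts"
proof -
  assume "g ` set ts \<subseteq> H"
  then have "\<forall>\<^sub>F n in U. \<forall>t\<in>set ts. rep (q (g t)) n = g t n"
    by (intro eventually_ball_finite) (auto intro: rep_q)
  then show ?thesis by eventually_elim simp
qed

text \<open>Functions of \<open>N\<close> are computed on representatives, which differ from the
  given sequences on a \<open>U\<close>-small set. Membership in \<open>H\<close> is carried through
  the induction because \<open>q_eq_iff\<close> compares elements of \<open>H\<close> only.\<close>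

lemma eval_N:
  assumes "is_term L t" and e: "\<And>w. e w \<in> H"
  shows "(\<lambda>n. eval M (\<lambda>w. e w n) t) \<in> H \<and>
    eval N (\<lambda>w. q (e w)) t = q (\<lambda>n. eval M (\<lambda>w. e w n) t)"
  using assms(1)
proof (induction t)
  case (Var v)
  then show ?case using e by simp
next
  case (Fun f ts)
  define g where "g = (\<lambda>t n. eval M (\<lambda>w. e w n) t)"
  have g: "g t \<in> H" "eval N (\<lambda>w. q (e w)) t = q (g t)" if "t \<in> set ts" for t
    using Fun that unfolding g_def by auto
  have f: "f \<in> funs L" "length ts = farity L f" using Fun.prems by auto
  have 1: "(\<lambda>n. ifun M f (map (\<lambda>t. g t n) ts)) \<in> H"
    using fun_closed[OF f(1), of "map g ts"] f g by (auto simp: comp_def)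
  have 2: "(\<lambda>n. ifun M f (map (\<lambda>t. rep (q (g t)) n) ts)) \<in> H"
    using fun_closed[OF f(1), of "map (\<lambda>t. rep (q (g t))) ts"] f g
    by (simp add: comp_def rep_in image_subset_iff)
  have "map (eval N (\<lambda>w. q (e w))) ts = map (\<lambda>t. q (g t)) ts"
    using g by simp
  then have "eval N (\<lambda>w. q (e w)) (Fun f ts) = q (\<lambda>n. ifun M f (map (\<lambda>t. rep (q (g t)) n) ts))"
    by (simp add: N_def comp_def del: map_eq_conv)
  also have "\<dots> = q (\<lambda>n. ifun M f (map (\<lambda>t. g t n) ts))"
    unfolding q_eq_iff[OF 2 1]
    by (rule eventually_mono[OF eventually_rep_q_map[of g ts]]) (use g in \<open>auto simp del: map_eq_conv\<close>)
  finally show ?case using 1 by (simp add: g_def)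
qed

text \<open>Negation uses that \<open>U\<close> is an ultrafilter. For \<open>Ex\<close>, closure
  under Skolem functions supplies a sequence inside \<open>H\<close> that is a witness at every
  index where there is one.\<close>

lemma sat_N:
  assumes "is_formula L \<phi>" and "\<And>w. e w \<in> H"
  shows "sat N (\<lambda>w. q (e w)) \<phi> \<longleftrightarrow> (\<forall>\<^sub>F n in U. sat M (\<lambda>w. e w n) \<phi>)"
  using assms
proof (induction \<phi> arbitrary: e)
  case (Eq s t)
  then show ?case using eval_N[of s e] eval_N[of t e] by (simp add: q_eq_iff)
next
  case (Rel R ts)
  define g where "g = (\<lambda>t n. eval M (\<lambda>w. e w n) t)"
  have g: "g t \<in> H" "eval N (\<lambda>w. q (e w)) t = q (g t)" if "t \<in> set ts" for t
    using Rel eval_N[of t e] that unfolding g_def by auto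
  have "map (eval N (\<lambda>w. q (e w))) ts = map (\<lambda>t. q (g t)) ts"
    using g by simp
  then have "sat N (\<lambda>w. q (e w)) (Rel R ts) \<longleftrightarrow>
      (\<forall>\<^sub>F n in U. irel M R (map (\<lambda>t. rep (q (g t)) n) ts))"
    by (simp add: N_def comp_def del: map_eq_conv)
  also have "\<dots> \<longleftrightarrow> (\<forall>\<^sub>F n in U. irel M R (map (\<lambda>t. g t n) ts))"
    by (rule eventually_subst, rule eventually_mono[OF eventually_rep_q_map[of g ts]])
       (use g in \<open>auto simp del: map_eq_conv\<close>)
  finally show ?case by (simp add: g_def)
next
  case (Neg \<phi>)
  then show ?case by (simp add: ultrafilter_not_iff[OF ultra])
next
  case (And \<phi> \<psi>)
  then show ?case by (simp add: eventually_conj_iff)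
next
  case (Ex v \<phi>)
  have upd: "sat N ((\<lambda>w. q (e w))(v := q h)) \<phi> \<longleftrightarrow>
      (\<forall>\<^sub>F n in U. sat M ((\<lambda>w. e w n)(v := h n)) \<phi>)" if "h \<in> H" for h
  proof -
    have "(\<lambda>w. q (e w))(v := q h) = (\<lambda>w. q ((e(v := h)) w))" by auto
    moreover have "(\<lambda>w. (e(v := h)) w n) = (\<lambda>w. e w n)(v := h n)" for n by auto
    ultimately show ?thesis using Ex.IH[of "e(v := h)"] Ex.prems that by simp
  qed
  have "sat N (\<lambda>w. q (e w)) (Ex v \<phi>) \<longleftrightarrow> (\<exists>h\<in>H. sat N ((\<lambda>w. q (e w))(v := q h)) \<phi>)"
    by (simp add: N_def)
  also have "\<dots> \<longleftrightarrow> (\<exists>h\<in>H. \<forall>\<^sub>F n in U. sat M ((\<lambda>w. e w n)(v := h n)) \<phi>)"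
    using upd by blast
  also have "\<dots> \<longleftrightarrow> (\<forall>\<^sub>F n in U. \<exists>a\<in>univ M. sat M ((\<lambda>w. e w n)(v := a)) \<phi>)"
  proof
    assume "\<exists>h\<in>H. \<forall>\<^sub>F n in U. sat M ((\<lambda>w. e w n)(v := h n)) \<phi>"
    then obtain h where h: "h \<in> H" "\<forall>\<^sub>F n in U. sat M ((\<lambda>w. e w n)(v := h n)) \<phi>" by blast
    from h(2) show "\<forall>\<^sub>F n in U. \<exists>a\<in>univ M. sat M ((\<lambda>w. e w n)(v := a)) \<phi>"
      by eventually_elim (use H_univ[OF h(1)] in blast)
  next
    assume *: "\<forall>\<^sub>F n in U. \<exists>a\<in>univ M. sat M ((\<lambda>w. e w n)(v := a)) \<phi>"
    obtain h where h: "h \<in> H" "\<forall>n. (\<exists>a\<in>univ M. sat M ((\<lambda>w. e w n)(v := a)) \<phi>) \<longrightarrow>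
        sat M ((\<lambda>w. e w n)(v := h n)) \<phi>"
      using skolem[of \<phi> e v] Ex.prems by auto
    from * have "\<forall>\<^sub>F n in U. sat M ((\<lambda>w. e w n)(v := h n)) \<phi>"
      by eventually_elim (use h(2) in blast)
    with h(1) show "\<exists>h\<in>H. \<forall>\<^sub>F n in U. sat M ((\<lambda>w. e w n)(v := h n)) \<phi>" by blast
  qed
  finally show ?case by simp
qed

lemma is_struct_N: "is_struct L N"
  unfolding is_struct_def
proof (intro conjI ballI)
  show "univ N \<noteq> {}" using H_nonempty by (simp add: N_def)
  fix f as assume f: "f \<in> funs L" and as: "as \<in> tuples N (farity L f)"
  then have "(\<lambda>n. ifun M f (map (\<lambda>a. rep a n) as)) \<in> H"
    using fun_closed[OF f, of "map rep as"]
    by (auto simp: tuples_def N_def comp_def subset_iff intro: rep_in)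
  then show "ifun N f as \<in> univ N" by (simp add: N_def)
qed

text \<open>An assignment into \<open>N\<close> lifts along \<open>rep\<close> to sequences in
  \<open>H\<close>, and at every index the sentence holds in \<open>M\<close>.\<close>

lemma N_models:
  assumes "M \<in> models L T" and "\<forall>\<sigma>\<in>T. is_sentence L \<sigma>"
  shows "N \<in> models L T"
  unfolding models_def
proof (intro CollectI conjI ballI allI impI is_struct_N)
  fix \<sigma> and e :: "nat \<Rightarrow> 'm" assume \<sigma>: "\<sigma> \<in> T" and e: "\<forall>v. e v \<in> univ N"
  have "\<forall>\<^sub>F n in U. sat M (\<lambda>w. rep (e w) n) \<sigma>"
    using assms(1) \<sigma> e H_univ rep_in by (auto simp: models_def N_def intro!: always_eventually)
  then have "sat N (\<lambda>w. q (rep (e w))) \<sigma>"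
    using sat_N[of \<sigma> "\<lambda>w. rep (e w)"] \<sigma> e assms(2) rep_in by (auto simp: is_sentence_def N_def)
  then show "sat N e \<sigma>" using e by (simp add: q_rep N_def)
qed

end

text \<open>Elements of the Skolem hull of the sequences \<open>a i\<close> are coded by formulas, so that the hull
  injects into the set of formulas without any cardinal arithmetic: a formula codes a list of
  sequences, conjunction codes concatenation, and the Skolem function of \<open>Ex v \<phi>\<close> applied to
  the list coded by \<open>\<psi>\<close> is coded by \<open>Neg (And (Ex v \<phi>) \<psi>)\<close>.\<close>

definition skolem_choice ::
    "('m, 'f, 'r) struct \<Rightarrow> nat \<Rightarrow> ('f, 'r) fm \<Rightarrow> ('i \<Rightarrow> 'm) list \<Rightarrow> 'i \<Rightarrow> 'm" where
  "skolem_choice M v \<phi> hs n =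
     (let P = \<lambda>a. sat M ((\<lambda>w. (hs ! w) n)(v := a)) \<phi>
      in SOME a. a \<in> univ M \<and> ((\<exists>a\<in>univ M. P a) \<longrightarrow> P a))"

fun coded :: "('m, 'f, 'r) struct \<Rightarrow> (nat \<Rightarrow> 'i \<Rightarrow> 'm) \<Rightarrow> ('f, 'r) fm \<Rightarrow> ('i \<Rightarrow> 'm) list" where
  "coded M a (Eq (Var i) t) = [a i]"
| "coded M a (And \<phi> \<psi>) = coded M a \<phi> @ coded M a \<psi>"
| "coded M a (Neg (And (Ex v \<phi>) \<psi>)) = [skolem_choice M v \<phi> (coded M a \<psi>)]"
| "coded M a _ = []"

definition skolem_hull ::
    "('f, 'r) language \<Rightarrow> ('m, 'f, 'r) struct \<Rightarrow> (nat \<Rightarrow> 'i \<Rightarrow> 'm) \<Rightarrow> ('i \<Rightarrow> 'm) set" where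
  "skolem_hull L M a = {h. \<exists>\<chi>. is_formula L \<chi> \<and> coded M a \<chi> = [h]}"

lemma skolem_choice_spec:
  assumes "univ M \<noteq> {}"
  shows "skolem_choice M v \<phi> hs n \<in> univ M"
    and "\<exists>b\<in>univ M. sat M ((\<lambda>w. (hs ! w) n)(v := b)) \<phi> \<Longrightarrow>
      sat M ((\<lambda>w. (hs ! w) n)(v := skolem_choice M v \<phi> hs n)) \<phi>"
proof -
  have "\<exists>a. a \<in> univ M \<and> ((\<exists>b\<in>univ M. sat M ((\<lambda>w. (hs ! w) n)(v := b)) \<phi>) \<longrightarrow>
      sat M ((\<lambda>w. (hs ! w) n)(v := a)) \<phi>)"
    using assms by blast
  from someI_ex[OF this]
  show "skolem_choice M v \<phi> hs n \<in> univ M"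
    and "\<exists>b\<in>univ M. sat M ((\<lambda>w. (hs ! w) n)(v := b)) \<phi> \<Longrightarrow>
      sat M ((\<lambda>w. (hs ! w) n)(v := skolem_choice M v \<phi> hs n)) \<phi>"
    unfolding skolem_choice_def Let_def by blast+
qed

lemma coded_univ:
  assumes "univ M \<noteq> {}" "\<And>i n. a i n \<in> univ M"
  shows "h \<in> set (coded M a \<chi>) \<Longrightarrow> h n \<in> univ M"
  using assms by (induction M a \<chi> rule: coded.induct) (auto intro: skolem_choice_spec(1))

lemma generator_in_skolem_hull: "a i \<in> skolem_hull L M a"
  unfolding skolem_hull_def by (auto intro!: exI[of _ "Eq (Var i) (Var i)"])

lemma skolem_hull_list_coded:
  assumes "set hs \<subseteq> skolem_hull L M a"
  shows "\<exists>\<psi>. is_formula L \<psi> \<and> coded M a \<psi> = hs"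
  using assms
proof (induction hs)
  case Nil
  \<comment> \<open>This formula falls under the last clause of \<open>coded\<close>, so it codes
    the empty list.\<close>
  show ?case by (rule exI[of _ "Ex 0 (Eq (Var 0) (Var 0))"]) simp
next
  case (Cons h hs)
  then obtain \<psi> \<chi> where "is_formula L \<psi>" "coded M a \<psi> = hs" "is_formula L \<chi>" "coded M a \<chi> = [h]"
    by (auto simp: skolem_hull_def)
  then show ?case by (intro exI[of _ "And \<chi> \<psi>"]) simp
qed

text \<open>A code holds only finitely many sequences, so the assignment is cut to the variables
  below a bound \<open>k\<close> of the free variables of \<phi>; what \<open>!\<close> returns
  beyond the list does not affect \<phi>.\<close>

lemma skolem_hull_closed:
  assumes "univ M \<noteq> {}" and "is_formula L \<phi>" and e: "\<And>w. e w \<in> skolem_hull L M a"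
  shows "\<exists>h\<in>skolem_hull L M a. \<forall>n. (\<exists>b\<in>univ M. sat M ((\<lambda>w. e w n)(v := b)) \<phi>) \<longrightarrow>
      sat M ((\<lambda>w. e w n)(v := h n)) \<phi>"
proof -
  obtain k where k: "\<And>w. w \<in> fv \<phi> \<Longrightarrow> w < k"
    using finite_fv[of \<phi>] unfolding finite_nat_set_iff_bounded by auto
  obtain \<psi> where \<psi>: "is_formula L \<psi>" "coded M a \<psi> = map e [0..<k]"
    using skolem_hull_list_coded[of "map e [0..<k]" L M a] e by (metis image_subset_iff list.set_map)
  let ?h = "skolem_choice M v \<phi> (map e [0..<k])"
  have "?h \<in> skolem_hull L M a"
    unfolding skolem_hull_def using \<psi> assms(2)
    by (intro CollectI exI[of _ "Neg (And (Ex v \<phi>) \<psi>)"]) simp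
  moreover have "sat M ((\<lambda>w. e w n)(v := b)) \<phi> = sat M ((\<lambda>w. (map e [0..<k] ! w) n)(v := b)) \<phi>"
    for n b using k by (intro sat_cong) auto
  ultimately show ?thesis
    using skolem_choice_spec(2)[OF assms(1), of "map e [0..<k]" _ v \<phi>] by (intro bexI[of _ ?h]) simp_all
qed

text \<open>The quotient of the hull has to live on the type \<open>'m\<close>. Each class modulo
  \<open>U\<close> is sent to a formula coding one of its members, and this formula is sent into
  \<open>'m\<close> by the given injection.\<close>

lemma ex_skolem_ultrapower:
  fixes M :: "('m, 'f, 'r) struct" and U :: "'i filter"
  assumes card: "{\<phi>::('f, 'r) fm. is_formula L \<phi>} \<lesssim> (UNIV :: 'm set)"
    and str: "is_struct L M" and U: "ultrafilter U" and a: "\<And>i n. a i n \<in> univ M"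
  shows "\<exists>q. skolem_ultrapower L M U (skolem_hull L M a) q"
proof -
  obtain j :: "('f, 'r) fm \<Rightarrow> 'm" where j: "inj_on j {\<phi>. is_formula L \<phi>}"
    using card unfolding lepoll_def by blast
  have ne: "univ M \<noteq> {}" using str by (simp add: is_struct_def)
  define eqv where "eqv = (\<lambda>h h'. \<forall>\<^sub>F n in U. (h n :: 'm) = h' n)"
  have eqv_sym: "eqv h h' \<Longrightarrow> eqv h' h" for h h'
    unfolding eqv_def by (erule eventually_mono) simp
  have eqv_trans: "eqv h h' \<Longrightarrow> eqv h' h'' \<Longrightarrow> eqv h h''" for h h' h''
    unfolding eqv_def by (erule (1) eventually_elim2) simp
  \<comment> \<open>The choice ranges over codes of all sequences equivalent to \<open>h\<close>, so
    it depends on the class of \<open>h\<close> alone.\<close>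
  define code where "code = (\<lambda>h. SOME \<chi>. is_formula L \<chi> \<and> (\<exists>h'. coded M a \<chi> = [h'] \<and> eqv h h'))"
  have code: "is_formula L (code h) \<and> (\<exists>h'. coded M a (code h) = [h'] \<and> eqv h h')"
    if "h \<in> skolem_hull L M a" for h
    unfolding code_def by (rule someI_ex) (use that in \<open>auto simp: skolem_hull_def eqv_def\<close>)
  have code_eq: "code h = code h' \<longleftrightarrow> eqv h h'"
    if "h \<in> skolem_hull L M a" "h' \<in> skolem_hull L M a" for h h'
  proof
    assume "code h = code h'"
    with code[OF that(1)] code[OF that(2)] show "eqv h h'"
      by (metis eqv_sym eqv_trans list.inject)
  next
    assume "eqv h h'"
    then have "eqv h = eqv h'" using eqv_sym eqv_trans by blast
    then show "code h = code h'" by (simp add: code_def)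
  qed
  have "skolem_ultrapower L M U (skolem_hull L M a) (\<lambda>h. j (code h))"
  proof
    show "ultrafilter U" "is_struct L M" by fact+
    show "skolem_hull L M a \<noteq> {}" using generator_in_skolem_hull by blast
    show "h n \<in> univ M" if h: "h \<in> skolem_hull L M a" for h n
    proof -
      obtain \<chi> where "coded M a \<chi> = [h]" using h by (auto simp: skolem_hull_def)
      then show ?thesis by (intro coded_univ[of M a h \<chi>] ne a) simp
    qed
    show "\<exists>h\<in>skolem_hull L M a. \<forall>n. (\<exists>b\<in>univ M. sat M ((\<lambda>w. e w n)(v := b)) \<phi>) \<longrightarrow>
      sat M ((\<lambda>w. e w n)(v := h n)) \<phi>"
      if "is_formula L \<phi>" "\<And>w. e w \<in> skolem_hull L M a" for \<phi> e v
      using skolem_hull_closed[OF ne that] .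
    show "j (code h) = j (code h') \<longleftrightarrow> (\<forall>\<^sub>F n in U. h n = h' n)"
      if "h \<in> skolem_hull L M a" "h' \<in> skolem_hull L M a" for h h'
      using code_eq[OF that] code[OF that(1)] code[OF that(2)] inj_on_eq_iff[OF j]
      by (auto simp: eqv_def)
  qed
  then show ?thesis by blast
qed

section \<open>Uniform finiteness\<close>

lemma assign_nth:
  "distinct xs \<Longrightarrow> length as = length xs \<Longrightarrow> i < length xs \<Longrightarrow> assign xs as (xs ! i) = as ! i"
  by (simp add: assign_def map_of_zip_nth)

lemma map_assign: "distinct xs \<Longrightarrow> length as = length xs \<Longrightarrow> map (assign xs as) xs = as"
  by (intro nth_equalityI) (simp_all add: assign_nth)

lemma sat_at_eq_sat:
  assumes "is_formula_in L xs \<phi>" and "length as = length xs"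
    and "\<And>i. i < length xs \<Longrightarrow> e (xs ! i) = as ! i"
  shows "sat_at M xs as \<phi> \<longleftrightarrow> sat M e \<phi>"
  unfolding sat_at_def
proof (rule sat_cong)
  fix v assume "v \<in> fv \<phi>"
  then obtain i where "i < length xs" "v = xs ! i"
    using assms(1) unfolding is_formula_in_def by (metis in_set_conv_nth subsetD)
  then show "assign xs as v = e v"
    using assms by (simp add: assign_nth is_formula_in_def)
qed

lemma sat_at_map_eq_sat: "is_formula_in L xs \<phi> \<Longrightarrow> sat_at M xs (map e xs) \<phi> \<longleftrightarrow> sat M e \<phi>"
  by (rule sat_at_eq_sat) auto

section \<open>Bounding alternation by compactness\<close>

text \<open>Pigeonhole: two even-indexed points lie in one member of the finite family, and
  convexity puts an odd-indexed point between them into the union.\<close>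

lemma alternating_not_finite_union_convex:
  fixes c :: "nat \<Rightarrow> 'm"
  assumes trans: "\<And>a b c. a \<in> univ M \<Longrightarrow> b \<in> univ M \<Longrightarrow> c \<in> univ M \<Longrightarrow>
      less_in M lt a b \<Longrightarrow> less_in M lt b c \<Longrightarrow> less_in M lt a c"
    and c: "\<And>i. c i \<in> univ M" "\<And>i. less_in M lt (c i) (c (Suc i))"
    and alt: "\<And>i. c i \<in> \<Union>\<C> \<longleftrightarrow> even i"
    and fin: "finite \<C>" and conv: "\<And>C. C \<in> \<C> \<Longrightarrow> convex_in M lt C"
  shows False
proof -
  have less: "less_in M lt (c i) (c j)" if "i < j" for i j
    using that by (induction rule: less_Suc_induct) (auto intro: c trans[OF c(1) c(1) c(1)])
  have "\<exists>C\<in>\<C>. c (2 * i) \<in> C" for i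
    using alt[of "2 * i"] by auto
  then obtain f where f: "\<And>i. f i \<in> \<C>" "\<And>i. c (2 * i) \<in> f i" by metis
  have "\<not> inj f"
    using f(1) fin by (metis finite_imageD finite_subset image_subset_iff infinite_UNIV_nat)
  then obtain i j where ij: "i < j" "f i = f j"
    by (metis injI linorder_neq_iff)
  have "c (Suc (2 * i)) \<in> f i"
  proof -
    have "less_in M lt (c (Suc (2 * i))) (c (2 * j))" using ij by (intro less) simp
    moreover have "c (2 * j) \<in> f i" using f(2)[of j] ij by simp
    ultimately show ?thesis
      using conv[OF f(1)[of i]] f(2)[of i] c[of "Suc (2 * i)"] c(2)[of "2 * i"]
      unfolding convex_in_def by blast
  qed
  with f(1)[of i] alt[of "Suc (2 * i)"] show False by auto
qed

text \<open>If every \<open>K\<close> fails, the failing parameters and chains, read as sequences in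
  \<open>K\<close>, yield one parameter tuple in \<open>N\<close> with an infinite alternating
  chain. Since \<open>N\<close> is again a model of \<open>T\<close>, weak o-minimality applies to
  it.\<close>

lemma weakly_o_minimal_uniformly_finite:
  fixes L :: "('f, 'r) language" and M :: "('m, 'f, 'r) struct"
  assumes card: "{\<phi>::('f, 'r) fm. is_formula L \<phi>} \<lesssim> (UNIV :: 'm set)"
    and lt: "lt \<in> rels L" "rarity L lt = 2"
    and T: "\<forall>\<sigma>\<in>T. is_sentence L \<sigma>"
    and lin: "(models L T :: ('m, 'f, 'r) struct set) \<subseteq> models L (inf_lin_ord lt)"
    and wom: "weakly_o_minimal TYPE('m) L lt T"
    and M: "M \<in> models L T" and \<phi>: "is_formula_in L (x # ys) \<phi>"
  shows "\<exists>K. \<forall>bs\<in>tuples M (length ys). \<not> (\<exists>c. (\<forall>i\<le>K. c i \<in> univ M) \<and>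
    (\<forall>i<K. less_in M lt (c i) (c (Suc i))) \<and>
    (\<forall>i\<le>K. sat_at M (x # ys) (c i # bs) \<phi> \<longleftrightarrow> even i))"
proof (rule ccontr)
  let ?m = "length ys"
  let ?alt = "\<lambda>K bs c. (\<forall>i\<le>K. c i \<in> univ M) \<and> (\<forall>i<K. less_in M lt (c i) (c (Suc i))) \<and>
    (\<forall>i\<le>K. sat_at M (x # ys) (c i # bs) \<phi> \<longleftrightarrow> even i)"
  assume "\<not> ?thesis"
  then have "\<forall>K. \<exists>bs. bs \<in> tuples M ?m \<and> (\<exists>c. ?alt K bs c)" by blast
  then obtain bs where bs: "\<And>K. bs K \<in> tuples M ?m" and "\<forall>K. \<exists>c. ?alt K (bs K) c"
    by metis
  then obtain c where "\<And>K. ?alt K (bs K) (c K)" by metis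
  then have c: "i \<le> K \<Longrightarrow> c K i \<in> univ M"
    "i < K \<Longrightarrow> less_in M lt (c K i) (c K (Suc i))"
    "i \<le> K \<Longrightarrow> sat_at M (x # ys) (c K i # bs K) \<phi> \<longleftrightarrow> even i" for K i by blast+
  \<comment> \<open>Generators with index below \<open>?m\<close> are the parameters, the others are
    the chain points. At index \<open>n\<close> the chain is only controlled up to its point
    \<open>n\<close>, so \<open>min\<close> truncates there and keeps all values in the
    universe.\<close>
  define a where "a k n = (if k < ?m then bs n ! k else c n (min (k - ?m) n))" for k n
  have a_univ: "a k n \<in> univ M" for k n
    using bs[of n] c(1) unfolding a_def tuples_def by (auto simp: subset_iff)
  \<comment> \<open>As \<open>U\<close> refines the filter at infinity, each fixed position is
    eventually unaffected by the truncation.\<close>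
  obtain U :: "nat filter" where U: "U \<le> sequentially" "ultrafilter U"
    using ex_ultrafilter_le[of sequentially] by auto
  have str: "is_struct L M" using M by (simp add: models_def)
  obtain q where "skolem_ultrapower L M U (skolem_hull L M a) q"
    using ex_skolem_ultrapower[where a = a, OF card str U(2) a_univ] by blast
  then interpret skolem_ultrapower L M U "skolem_hull L M a" q .
  have N: "N \<in> models L T" by (rule N_models[OF M T])
  have aH: "a k \<in> skolem_hull L M a" for k by (rule generator_in_skolem_hull)
  have evU: "\<forall>\<^sub>F n in U. i < n" for i
    using U(1) eventually_gt_at_top[of i] by (rule filter_leD)
  define b' where "b' = map (\<lambda>k. q (a k)) [0..<?m]"
  define c' where "c' i = q (a (?m + i))" for i
  have b': "b' \<in> tuples N ?m" and c': "c' i \<in> univ N" for i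
    using aH by (auto simp: b'_def c'_def tuples_def N_def)
  have alt: "sat_at N (x # ys) (c' i # b') \<phi> \<longleftrightarrow> even i" for i
  proof -
    define hs where "hs = a (?m + i) # map a [0..<?m]"
    \<comment> \<open>\<open>sat_N\<close> asks for all variables to be sent into the hull, hence
      the default \<open>a 0\<close>.\<close>
    define e where "e w = (if w \<in> set (x # ys) then assign (x # ys) hs w else a 0)" for w
    have dist: "distinct (x # ys)" using \<phi> by (simp add: is_formula_in_def)
    have e: "e ((x # ys) ! k) = hs ! k" if "k < length (x # ys)" for k
    proof -
      have "(x # ys) ! k \<in> set (x # ys)" using that by (rule nth_mem)
      then show ?thesis using assign_nth[OF dist _ that, of hs] by (simp add: e_def hs_def)
    qed
    have e_Cons: "e x = a (?m + i)" "k < ?m \<Longrightarrow> e (ys ! k) = a k" for k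
      using e[of 0] e[of "Suc k"] by (auto simp: hs_def)
    have hsH: "hs ! k \<in> skolem_hull L M a" if "k < length (x # ys)" for k
      using that aH by (auto simp: hs_def nth_Cons split: nat.splits)
    have eH: "e w \<in> skolem_hull L M a" for w
    proof (cases "w \<in> set (x # ys)")
      case True
      then obtain k where "k < length (x # ys)" "w = (x # ys) ! k" by (metis in_set_conv_nth)
      then show ?thesis using e hsH by metis
    qed (simp add: e_def aH)
    have "sat_at N (x # ys) (c' i # b') \<phi> \<longleftrightarrow> sat N (\<lambda>w. q (e w)) \<phi>"
      by (rule sat_at_eq_sat[OF \<phi>])
        (auto simp: e_Cons b'_def c'_def nth_Cons split: nat.splits)
    also have "\<dots> \<longleftrightarrow> (\<forall>\<^sub>F n in U. sat M (\<lambda>w. e w n) \<phi>)"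
      using \<phi> eH by (intro sat_N) (auto simp: is_formula_in_def)
    also have "\<dots> \<longleftrightarrow> (\<forall>\<^sub>F n in U. even i)"
    proof (rule eventually_subst, rule eventually_mono[OF evU[of i]])
      fix n assume n: "i < n"
      have "sat_at M (x # ys) (c n i # bs n) \<phi> \<longleftrightarrow> sat M (\<lambda>w. e w n) \<phi>"
        using bs[of n] n by (intro sat_at_eq_sat[OF \<phi>])
          (auto simp: e_Cons a_def tuples_def nth_Cons split: nat.splits)
      with c(3)[of i n] n show "sat M (\<lambda>w. e w n) \<phi> \<longleftrightarrow> even i" by simp
    qed
    also have "\<dots> \<longleftrightarrow> even i" using U(2) by (simp add: ultrafilter_def)
    finally show ?thesis .
  qed
  have less: "less_in N lt (c' i) (c' (Suc i))" for i
  proof -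
    \<comment> \<open>The strict bound \<open>i < n\<close> keeps the point \<open>Suc i\<close>
      untruncated as well.\<close>
    let ?e = "\<lambda>w. if w = 0 then a (?m + i) else a (?m + Suc i)"
    have "\<forall>\<^sub>F n in U. sat M (\<lambda>w. ?e w n) (less_fm lt 0 1)"
      by (rule eventually_mono[OF evU[of i]]) (use c(2) in \<open>auto simp: a_def min_def Suc_le_eq\<close>)
    then have "sat N (\<lambda>w. q (?e w)) (less_fm lt 0 1)"
      by (subst sat_N) (use lt aH in auto)
    then show ?thesis by (simp add: c'_def)
  qed
  define D where "D = {d \<in> univ N. sat_at N (x # ys) (d # b') \<phi>}"
  have "definable L N D" unfolding definable_def D_def using \<phi> b' by blast
  from wom[unfolded weakly_o_minimal_def, rule_format, OF N this]
  obtain \<C> where \<C>: "finite \<C>" "\<And>C. C \<in> \<C> \<Longrightarrow> convex_in N lt C" "D = \<Union>\<C>"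
    by blast
  have alt_\<C>: "c' i \<in> \<Union>\<C> \<longleftrightarrow> even i" for i
    unfolding \<C>(3)[symmetric] D_def using alt[of i] c'[of i] by simp
  have "N \<in> models L (inf_lin_ord lt)" using N lin by blast
  then have trans: "\<forall>a\<in>univ N. \<forall>b\<in>univ N. \<forall>c\<in>univ N.
      less_in N lt a b \<longrightarrow> less_in N lt b c \<longrightarrow> less_in N lt a c"
    unfolding models_inf_lin_ord by (elim conjE)
  show False
    by (rule alternating_not_finite_union_convex[OF _ c' less alt_\<C> \<C>(1,2)])
      (use trans in blast)
qed

section \<open>Convex components and the VC1 property\<close>

text \<open>Renaming by \<open>\<exists>u. u = v \<and> \<chi>\<close> avoids substitution and hence variable capture.\<close>

definition ren :: "(nat \<times> nat) list \<Rightarrow> ('f, 'r) fm \<Rightarrow> ('f, 'r) fm" where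
  "ren ps \<chi> = foldr (\<lambda>(u, v) \<chi>. Ex u (And (Eq (Var u) (Var v)) \<chi>)) ps \<chi>"

lemma is_formula_ren [simp]: "is_formula L (ren ps \<chi>) \<longleftrightarrow> is_formula L \<chi>"
  by (induction ps) (auto simp: ren_def)

lemma fv_ren:
  "fst ` set ps \<inter> snd ` set ps = {} \<Longrightarrow> fv (ren ps \<chi>) \<subseteq> (fv \<chi> - fst ` set ps) \<union> snd ` set ps"
proof (induction ps)
  case (Cons p ps)
  have "fv (ren (p # ps) \<chi>) = insert (snd p) (fv (ren ps \<chi>)) - {fst p}"
    using Cons.prems by (cases p) (auto simp: ren_def)
  moreover have "fv (ren ps \<chi>) \<subseteq> (fv \<chi> - fst ` set ps) \<union> snd ` set ps"
    using Cons.prems by (intro Cons.IH) auto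
  ultimately show ?case by auto
qed (simp add: ren_def)

text \<open>The quantifiers act one after the other; since no target variable is also a source, the
  result is a simultaneous renaming. The targets need values in the universe, over which the
  quantifiers range.\<close>

lemma sat_ren:
  assumes "distinct (map fst ps)" "fst ` set ps \<inter> snd ` set ps = {}"
    and "\<And>u v. (u, v) \<in> set ps \<Longrightarrow> e v \<in> univ M"
  shows "sat M e (ren ps \<chi>) \<longleftrightarrow> sat M (\<lambda>w. case map_of ps w of Some v \<Rightarrow> e v | None \<Rightarrow> e w) \<chi>"
  using assms
proof (induction ps arbitrary: e)
  case Nil
  show ?case by (simp add: ren_def)
next
  case (Cons p ps)
  obtain u v where p: "p = (u, v)" by force
  have snd: "v' \<noteq> u" if "(u', v') \<in> set ps" for u' v'
    using Cons.prems(2) p that by force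
  have "u \<noteq> v" "e v \<in> univ M" using Cons.prems p by auto
  then have "sat M e (ren (p # ps) \<chi>) \<longleftrightarrow> sat M (e(u := e v)) (ren ps \<chi>)"
    by (auto simp: ren_def p)
  also have "\<dots> \<longleftrightarrow> sat M (\<lambda>w. case map_of ps w of Some v' \<Rightarrow> (e(u := e v)) v' | None \<Rightarrow> (e(u := e v)) w) \<chi>"
    using Cons.prems snd by (intro Cons.IH) (auto dest: snd)
  also have "(\<lambda>w. case map_of ps w of Some v' \<Rightarrow> (e(u := e v)) v' | None \<Rightarrow> (e(u := e v)) w) =
      (\<lambda>w. case map_of (p # ps) w of Some v \<Rightarrow> e v | None \<Rightarrow> e w)"
  proof
    fix w
    have "w \<noteq> u" if "map_of ps w = Some v'" for v'
      using map_of_SomeD[OF that] Cons.prems(1) p by force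
    then show "(case map_of ps w of Some v' \<Rightarrow> (e(u := e v)) v' | None \<Rightarrow> (e(u := e v)) w) =
      (case map_of (p # ps) w of Some v \<Rightarrow> e v | None \<Rightarrow> e w)"
      by (cases "map_of ps w") (auto simp: p dest: snd[OF map_of_SomeD])
  qed
  finally show ?case .
qed

lemma sat_ren_single:
  "x \<noteq> z \<Longrightarrow> e z \<in> univ M \<Longrightarrow> sat M e (ren [(x, z)] \<chi>) \<longleftrightarrow> sat M (e(x := e z)) \<chi>"
  by (auto simp: ren_def)

lemma is_formula_Truth [simp]: "is_formula L Truth" and fv_Truth [simp]: "fv Truth = {}"
  and sat_Truth [simp]: "sat M e Truth"
  by (simp_all add: Truth_def)

definition Disj :: "('f, 'r) fm list \<Rightarrow> ('f, 'r) fm" where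
  "Disj \<phi>s = Neg (foldr And (map Neg \<phi>s) Truth)"

lemma is_formula_Disj [simp]: "is_formula L (Disj \<phi>s) \<longleftrightarrow> (\<forall>\<phi>\<in>set \<phi>s. is_formula L \<phi>)"
  by (induction \<phi>s) (auto simp: Disj_def)

lemma fv_Disj [simp]: "fv (Disj \<phi>s) = (\<Union>\<phi>\<in>set \<phi>s. fv \<phi>)"
  by (induction \<phi>s) (auto simp: Disj_def)

lemma sat_Disj [simp]: "sat M e (Disj \<phi>s) \<longleftrightarrow> (\<exists>\<phi>\<in>set \<phi>s. sat M e \<phi>)"
  by (auto simp: Disj_def sat_foldr_And)

text \<open>\<open>alt_chain M lt P j a\<close>: there is a chain \<open>c\<^sub>0 < \<dots> < c\<^sub>j = a\<close> along which \<open>P\<close> alternates,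
  starting with a true value. The set \<open>upper_set M lt P j\<close> consists of the points above such a
  chain; the successive differences of these final segments are the convex components of \<open>P\<close> and
  of its complement.\<close>

primrec alt_chain ::
    "('m, 'f, 'r) struct \<Rightarrow> 'r \<Rightarrow> ('m \<Rightarrow> bool) \<Rightarrow> nat \<Rightarrow> 'm \<Rightarrow> bool" where
  "alt_chain M lt P 0 a \<longleftrightarrow> P a"
| "alt_chain M lt P (Suc j) a \<longleftrightarrow>
     (P a \<longleftrightarrow> odd j) \<and> (\<exists>d\<in>univ M. less_in M lt d a \<and> alt_chain M lt P j d)"

definition upper_set :: "('m, 'f, 'r) struct \<Rightarrow> 'r \<Rightarrow> ('m \<Rightarrow> bool) \<Rightarrow> nat \<Rightarrow> 'm set" where
  "upper_set M lt P j =
     {a \<in> univ M. \<exists>d\<in>univ M. \<not> less_in M lt a d \<and> alt_chain M lt P j d}"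

text \<open>Two variables suffice at all levels: once \<open>z\<close> is chosen, \<open>ren\<close>
  rebinds \<open>x\<close> to its value, which frees \<open>z\<close> for reuse inside.\<close>

primrec chain_fm :: "'r \<Rightarrow> nat \<Rightarrow> nat \<Rightarrow> ('f, 'r) fm \<Rightarrow> nat \<Rightarrow> ('f, 'r) fm" where
  "chain_fm lt x z \<phi> 0 = \<phi>"
| "chain_fm lt x z \<phi> (Suc j) =
     And (if odd j then \<phi> else Neg \<phi>)
       (Ex z (And (less_fm lt z x) (ren [(x, z)] (chain_fm lt x z \<phi> j))))"

definition upper_fm :: "'r \<Rightarrow> nat \<Rightarrow> nat \<Rightarrow> ('f, 'r) fm \<Rightarrow> nat \<Rightarrow> ('f, 'r) fm" where
  "upper_fm lt x z \<phi> j =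
     Ex z (And (Neg (less_fm lt x z)) (ren [(x, z)] (chain_fm lt x z \<phi> j)))"

lemma is_formula_upper_fm:
  assumes "lt \<in> rels L" "rarity L lt = 2" "is_formula L \<phi>"
  shows "is_formula L (upper_fm lt x z \<phi> j)"
proof -
  have "is_formula L (chain_fm lt x z \<phi> j)" using assms by (induction j) auto
  with assms show ?thesis by (simp add: upper_fm_def)
qed

lemma fv_upper_fm:
  assumes "x \<noteq> z"
  shows "fv (upper_fm lt x z \<phi> j) \<subseteq> insert x (fv \<phi>)"
proof -
  have ren: "fv (ren [(x, z)] \<chi>) \<subseteq> insert z (fv \<chi>)" for \<chi> :: "('f, 'r) fm"
    using fv_ren[of "[(x, z)]" \<chi>] assms by auto
  have "fv (chain_fm lt x z \<phi> j) \<subseteq> insert x (fv \<phi>)"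
  proof (induction j)
    case (Suc j)
    with ren[of "chain_fm lt x z \<phi> j"] show ?case by auto
  qed auto
  with ren[of "chain_fm lt x z \<phi> j"] show ?thesis by (auto simp: upper_fm_def)
qed

text \<open>The inner formula is evaluated with \<open>x\<close> and \<open>z\<close> both reset to
  \<open>d\<close>, so the induction quantifies over \<open>e\<close>. As \<open>z\<close> is not
  free in \<phi>, the predicate that alternates stays the same.\<close>

lemma sat_chain_fm:
  assumes "x \<noteq> z" "z \<notin> fv \<phi>" "e x \<in> univ M"
  shows "sat M e (chain_fm lt x z \<phi> j) \<longleftrightarrow>
    alt_chain M lt (\<lambda>a. sat M (e(x := a)) \<phi>) j (e x)"
proof -
  have "\<forall>e. e x \<in> univ M \<longrightarrow> sat M e (chain_fm lt x z \<phi> j) =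
    alt_chain M lt (\<lambda>a. sat M (e(x := a)) \<phi>) j (e x)"
  proof (induction j)
    case (Suc j)
    show ?case
    proof (intro allI impI)
      fix e assume "e x \<in> univ M"
      have "sat M (e(z := d)) (ren [(x, z)] (chain_fm lt x z \<phi> j)) \<longleftrightarrow>
          alt_chain M lt (\<lambda>a. sat M (e(x := a)) \<phi>) j d" if d: "d \<in> univ M" for d
      proof -
        have "sat M (e(z := d)) (ren [(x, z)] (chain_fm lt x z \<phi> j)) \<longleftrightarrow>
            alt_chain M lt (\<lambda>a. sat M (e(z := d, x := d, x := a)) \<phi>) j d"
          using assms(1) d Suc.IH[rule_format, of "e(z := d, x := d)"]
          by (simp add: sat_ren_single)
        moreover have "sat M (e(z := d, x := d, x := a)) \<phi> = sat M (e(x := a)) \<phi>" for a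
          using assms(2) by (intro sat_cong) auto
        ultimately show ?thesis by simp
      qed
      then show "sat M e (chain_fm lt x z \<phi> (Suc j)) =
          alt_chain M lt (\<lambda>a. sat M (e(x := a)) \<phi>) (Suc j) (e x)"
        using assms(1) by auto
    qed
  qed (auto intro!: sat_cong)
  with assms(3) show ?thesis by blast
qed

lemma sat_upper_fm:
  assumes "x \<noteq> z" "z \<notin> fv \<phi>" "e x \<in> univ M"
  shows "sat M e (upper_fm lt x z \<phi> j) \<longleftrightarrow> e x \<in> upper_set M lt (\<lambda>a. sat M (e(x := a)) \<phi>) j"
proof -
  have "sat M (e(z := d)) (ren [(x, z)] (chain_fm lt x z \<phi> j)) \<longleftrightarrow>
      alt_chain M lt (\<lambda>a. sat M (e(x := a)) \<phi>) j d" if d: "d \<in> univ M" for d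
  proof -
    have "sat M (e(z := d)) (ren [(x, z)] (chain_fm lt x z \<phi> j)) \<longleftrightarrow>
        alt_chain M lt (\<lambda>a. sat M (e(z := d, x := d, x := a)) \<phi>) j d"
      using assms d sat_chain_fm[OF assms(1,2), of "e(z := d, x := d)" M lt j]
      by (simp add: sat_ren_single)
    moreover have "sat M (e(z := d, x := d, x := a)) \<phi> = sat M (e(x := a)) \<phi>" for a
      using assms(2) by (intro sat_cong) auto
    ultimately show ?thesis by simp
  qed
  then show ?thesis using assms by (auto simp: upper_fm_def upper_set_def)
qed

lemma alt_chain_iff_even: "alt_chain M lt P j a \<Longrightarrow> P a \<longleftrightarrow> even j"
  by (cases j) auto

text \<open>Unfolds a recursive chain into the kind of sequence whose length
  \<open>weakly_o_minimal_uniformly_finite\<close> bounds.\<close>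

lemma alt_chain_imp_sequence:
  assumes "alt_chain M lt P j a" "a \<in> univ M"
  shows "\<exists>c. c j = a \<and> (\<forall>i\<le>j. c i \<in> univ M) \<and> (\<forall>i<j. less_in M lt (c i) (c (Suc i))) \<and>
    (\<forall>i\<le>j. P (c i) \<longleftrightarrow> even i)"
  using assms
proof (induction j arbitrary: a)
  case 0
  then show ?case by (intro exI[of _ "\<lambda>_. a"]) simp
next
  case (Suc j)
  then obtain d where "d \<in> univ M" "less_in M lt d a" "alt_chain M lt P j d" by auto
  moreover from this Suc.IH obtain c where "c j = d" "\<forall>i\<le>j. c i \<in> univ M"
    "\<forall>i<j. less_in M lt (c i) (c (Suc i))" "\<forall>i\<le>j. P (c i) \<longleftrightarrow> even i" by blast
  ultimately show ?case
    using Suc.prems alt_chain_iff_even[OF Suc.prems(1)]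
    by (intro exI[of _ "c(Suc j := a)"]) (auto simp: le_Suc_eq less_Suc_eq)
qed

section \<open>Final segments of a linear ordering\<close>

locale linear_struct =
  fixes M :: "('m, 'f, 'r) struct" and lt :: 'r
  assumes irrefl: "a \<in> univ M \<Longrightarrow> \<not> less_in M lt a a"
    and trans: "a \<in> univ M \<Longrightarrow> b \<in> univ M \<Longrightarrow> c \<in> univ M \<Longrightarrow>
      less_in M lt a b \<Longrightarrow> less_in M lt b c \<Longrightarrow> less_in M lt a c"
    and total: "a \<in> univ M \<Longrightarrow> b \<in> univ M \<Longrightarrow> less_in M lt a b \<or> a = b \<or> less_in M lt b a"
begin

lemma upper_set_up:
  "a \<in> upper_set M lt P j \<Longrightarrow> b \<in> univ M \<Longrightarrow> less_in M lt a b \<Longrightarrow> b \<in> upper_set M lt P j"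
  unfolding upper_set_def using trans by blast

text \<open>The predicates may differ, so the segments arising from all formulas and parameters form
  one chain under inclusion. This is why a single parameter can define a type.\<close>

lemma upper_set_linear:
  "upper_set M lt P i \<subseteq> upper_set M lt Q j \<or> upper_set M lt Q j \<subseteq> upper_set M lt P i"
proof (rule ccontr)
  assume "\<not> ?thesis"
  then obtain a b where "a \<in> upper_set M lt P i" "a \<notin> upper_set M lt Q j"
    "b \<in> upper_set M lt Q j" "b \<notin> upper_set M lt P i" by blast
  moreover from this have "a \<in> univ M" "b \<in> univ M" by (auto simp: upper_set_def)
  ultimately show False using total upper_set_up by metis
qed

text \<open>Some chain of index \<open>j\<close> ends at a point \<open>d\<close> \<le>
  \<open>a\<close>; by parity \<open>d\<close> differs from \<open>a\<close>, so \<open>a\<close>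
  prolongs the chain.\<close>

lemma upper_set_Suc:
  assumes "a \<in> upper_set M lt P j" "P a \<longleftrightarrow> odd j"
  shows "a \<in> upper_set M lt P (Suc j)"
proof -
  obtain d where d: "a \<in> univ M" "d \<in> univ M" "\<not> less_in M lt a d" "alt_chain M lt P j d"
    using assms(1) unfolding upper_set_def by blast
  have "d \<noteq> a" using assms(2) alt_chain_iff_even[OF d(4)] by auto
  with d total[of a d] have "less_in M lt d a" by auto
  with d assms(2) have "alt_chain M lt P (Suc j) a" by auto
  with d(1) irrefl show ?thesis unfolding upper_set_def by blast
qed

text \<open>Look at the least \<open>n\<close> whose segment omits \<open>a\<close>; it is at most
  \<open>K\<close>. If \<open>P a\<close> holds, then \<open>a\<close> is in the segment of index 0,
  so \<open>n\<close> has a predecessor \<open>j\<close>, and \<open>upper_set_Suc\<close> forces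
  \<open>j\<close> to be even.\<close>

lemma iff_upper_set:
  assumes K: "upper_set M lt P K = {}" and a: "a \<in> univ M"
  shows "P a \<longleftrightarrow>
    (\<exists>j<K. even j \<and> a \<in> upper_set M lt P j \<and> a \<notin> upper_set M lt P (Suc j))"
proof
  assume "\<exists>j<K. even j \<and> a \<in> upper_set M lt P j \<and> a \<notin> upper_set M lt P (Suc j)"
  then show "P a" using upper_set_Suc by blast
next
  assume P: "P a"
  let ?n = "LEAST n. a \<notin> upper_set M lt P n"
  have n: "a \<notin> upper_set M lt P ?n" "?n \<le> K"
    using LeastI[of "\<lambda>n. a \<notin> upper_set M lt P n" K]
      Least_le[of "\<lambda>n. a \<notin> upper_set M lt P n" K] K by auto
  have "a \<in> upper_set M lt P 0" using P a irrefl unfolding upper_set_def by auto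
  then obtain j where j: "?n = Suc j" using n by (cases ?n) auto
  then have "a \<in> upper_set M lt P j" using not_less_Least[of j "\<lambda>n. a \<notin> upper_set M lt P n"] by auto
  then show "\<exists>j<K. even j \<and> a \<in> upper_set M lt P j \<and> a \<notin> upper_set M lt P (Suc j)"
    using n j P upper_set_Suc[of a P j] by (intro exI[of _ j]) auto
qed

end

section \<open>Defining types by inclusion of segments\<close>

text \<open>If \<phi> is the negation of another member of \<Delta>, the pair can also enter
  \<open>tp\<close> through the second set; the two conditions then agree.\<close>

lemma mem_tp_iff:
  "\<phi> \<in> \<Delta> \<Longrightarrow> b \<in> B \<Longrightarrow> (\<phi>, b) \<in> tp M x y \<Delta> a B \<longleftrightarrow> sat_at M (x @ y) (a @ b) \<phi>"
  by (auto simp: tp_def sat_at_def)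

text \<open>Meant for \<open>p = (\<psi>, i)\<close> and \<open>ps = zip y y'\<close>: the
  parameters of \<psi> are read from the copy \<open>y'\<close>, those of \<phi> from
  \<open>y\<close>.\<close>

definition incl_fm ::
    "'r \<Rightarrow> nat \<Rightarrow> nat \<Rightarrow> (nat \<times> nat) list \<Rightarrow> ('f, 'r) fm \<times> nat \<Rightarrow> ('f, 'r) fm \<Rightarrow> nat \<Rightarrow> ('f, 'r) fm" where
  "incl_fm lt x z ps p \<phi> j =
     Neg (Ex x (And (ren ps (upper_fm lt x z (fst p) (snd p))) (Neg (upper_fm lt x z \<phi> j))))"

text \<open>This is the criterion of \<open>iff_upper_set\<close>, with membership of the
  realization in a segment replaced by inclusion of the segment \<open>p\<close> in it.\<close>

definition type_def_fm ::
    "'r \<Rightarrow> nat \<Rightarrow> nat \<Rightarrow> (nat \<times> nat) list \<Rightarrow> ('f, 'r) fm \<times> nat \<Rightarrow> ('f, 'r) fm \<Rightarrow> nat \<Rightarrow> ('f, 'r) fm" where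
  "type_def_fm lt x z ps p \<phi> K =
     Disj (map (\<lambda>j. And (incl_fm lt x z ps p \<phi> j) (Neg (incl_fm lt x z ps p \<phi> (Suc j))))
       (filter even [0..<K]))"

lemma sat_incl_fm:
  fixes M :: "('m, 'f, 'r) struct"
  assumes dist: "distinct (x # z # y @ y')" and len: "length y' = length y"
    and \<psi>: "is_formula_in L (x # y) \<psi>" and \<phi>: "is_formula_in L (x # y) \<phi>"
    and b: "b \<in> tuples M (length y)" "b' \<in> tuples M (length y)"
  shows "sat_at M (y @ y') (b @ b') (incl_fm lt x z (zip y y') (\<psi>, i) \<phi> j) \<longleftrightarrow>
    upper_set M lt (\<lambda>a. sat_at M (x # y) (a # b') \<psi>) i
      \<subseteq> upper_set M lt (\<lambda>a. sat_at M (x # y) (a # b) \<phi>) j"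
proof -
  define e where "e = assign (y @ y') (b @ b')"
  have lens: "length b = length y" "length b' = length y" using b by (auto simp: tuples_def)
  have e: "e (y ! k) = b ! k" "e (y' ! k) = b' ! k" if "k < length y" for k
    using assign_nth[of "y @ y'" "b @ b'" k] assign_nth[of "y @ y'" "b @ b'" "length y + k"]
      dist len lens that by (auto simp: e_def nth_append)
  have xz: "x \<noteq> z" "z \<notin> fv \<psi>" "z \<notin> fv \<phi>"
    using dist \<phi> \<psi> by (auto simp: is_formula_in_def)
  have up\<phi>: "sat M (e(x := a)) (upper_fm lt x z \<phi> j) \<longleftrightarrow>
      a \<in> upper_set M lt (\<lambda>a. sat_at M (x # y) (a # b) \<phi>) j" if a: "a \<in> univ M" for a
  proof -
    have "sat_at M (x # y) (a # b) \<phi> = sat M (e(x := a)) \<phi>" for a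
      by (rule sat_at_eq_sat[OF \<phi>]) (use dist lens e in \<open>auto simp: nth_Cons split: nat.splits\<close>)
    then show ?thesis using a xz by (simp add: sat_upper_fm)
  qed
  have up\<psi>: "sat M (e(x := a)) (ren (zip y y') (upper_fm lt x z \<psi> i)) \<longleftrightarrow>
      a \<in> upper_set M lt (\<lambda>a. sat_at M (x # y) (a # b') \<psi>) i" if a: "a \<in> univ M" for a
  proof -
    \<comment> \<open>The renamed assignment gives the variables \<open>y\<close> the values
      \<open>b'\<close> and leaves \<open>x\<close> at \<open>a\<close>.\<close>
    let ?e = "\<lambda>w. case map_of (zip y y') w of Some v \<Rightarrow> (e(x := a)) v | None \<Rightarrow> (e(x := a)) w"
    have zip: "fst ` set (zip y y') = set y" "snd ` set (zip y y') = set y'"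
      using len by (metis map_fst_zip set_map, metis map_snd_zip set_map)
    have "sat M (e(x := a)) (ren (zip y y') (upper_fm lt x z \<psi> i)) \<longleftrightarrow>
        sat M ?e (upper_fm lt x z \<psi> i)"
    proof (rule sat_ren)
      show "(e(x := a)) v \<in> univ M" if "(u, v) \<in> set (zip y y')" for u v
      proof -
        obtain k where "k < length y" "v = y' ! k" using \<open>(u, v) \<in> set (zip y y')\<close> by (auto simp: set_zip)
        then show ?thesis using e(2) a b lens len by (auto simp: tuples_def subset_iff)
      qed
    qed (use dist len zip in auto)
    also have "?e x = a"
      using dist zip by (auto simp: map_of_eq_None_iff split: option.splits dest!: map_of_SomeD)
        (metis fst_conv image_eqI)
    then have "sat M ?e (upper_fm lt x z \<psi> i) \<longleftrightarrow>
        a \<in> upper_set M lt (\<lambda>a. sat M (?e(x := a)) \<psi>) i"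
      using sat_upper_fm[OF xz(1,2), of ?e M lt i] a by simp
    also have "(\<lambda>a. sat M (?e(x := a)) \<psi>) = (\<lambda>a. sat_at M (x # y) (a # b') \<psi>)"
    proof
      fix a'
      have "?e (y ! k) = b' ! k" if "k < length y" for k
        using that dist len e(2)[OF that] by (auto simp: map_of_zip_nth)
      then have "sat_at M (x # y) (a' # b') \<psi> \<longleftrightarrow> sat M (?e(x := a')) \<psi>"
        by (intro sat_at_eq_sat[OF \<psi>])
          (use dist lens in \<open>auto simp: nth_Cons simp del: option.case split: nat.splits\<close>)
      then show "sat M (?e(x := a')) \<psi> = sat_at M (x # y) (a' # b') \<psi>" by simp
    qed
    finally show ?thesis .
  qed
  have "sat_at M (y @ y') (b @ b') (incl_fm lt x z (zip y y') (\<psi>, i) \<phi> j) \<longleftrightarrow>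
      (\<forall>a\<in>univ M. a \<in> upper_set M lt (\<lambda>a. sat_at M (x # y) (a # b') \<psi>) i \<longrightarrow>
        a \<in> upper_set M lt (\<lambda>a. sat_at M (x # y) (a # b) \<phi>) j)"
    using up\<phi> up\<psi> by (auto simp: sat_at_def[of M "y @ y'"] incl_fm_def e_def[symmetric])
  moreover have "upper_set M lt P k \<subseteq> univ M" for P k by (auto simp: upper_set_def)
  ultimately show ?thesis by blast
qed

lemma is_formula_in_incl_fm:
  assumes dist: "distinct (x # z # y @ y')" and len: "length y' = length y"
    and lt: "lt \<in> rels L" "rarity L lt = 2"
    and \<psi>: "is_formula_in L (x # y) \<psi>" and \<phi>: "is_formula_in L (x # y) \<phi>"
  shows "is_formula_in L (y @ y') (incl_fm lt x z (zip y y') (\<psi>, i) \<phi> j)"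
proof -
  have zip: "fst ` set (zip y y') = set y" "snd ` set (zip y y') = set y'"
    using len by (metis map_fst_zip set_map, metis map_snd_zip set_map)
  have "x \<noteq> z" using dist by auto
  note fv = fv_upper_fm[OF this, of lt \<psi> i] fv_upper_fm[OF this, of lt \<phi> j]
  have "fv (ren (zip y y') (upper_fm lt x z \<psi> i)) \<subseteq>
      (fv (upper_fm lt x z \<psi> i) - set y) \<union> set y'"
    using fv_ren[of "zip y y'" "upper_fm lt x z \<psi> i"] dist unfolding zip by auto
  with fv show ?thesis
    using dist \<phi> \<psi> lt by (auto simp: is_formula_in_def incl_fm_def is_formula_upper_fm)
qed

lemma is_formula_in_type_def_fm:
  assumes "distinct (x # z # y @ y')" and "length y' = length y"
    and "lt \<in> rels L" "rarity L lt = 2"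
    and "is_formula_in L (x # y) (fst p)" and "is_formula_in L (x # y) \<phi>"
  shows "is_formula_in L (y @ y') (type_def_fm lt x z (zip y y') p \<phi> K)"
  using is_formula_in_incl_fm[OF assms, of "snd p"]
  by (auto simp: type_def_fm_def is_formula_in_def)

text \<open>The type of \<open>a\<close> over \<open>B\<close> is governed by the least segment
  containing \<open>a\<close>. It is named by a pair from a finite list, which becomes the index of
  the definition, and by one tuple from \<open>B\<close>.\<close>

lemma (in linear_struct) has_uniform_definition_1:
  assumes lt: "lt \<in> rels L" "rarity L lt = 2"
    and \<Delta>: "finite \<Delta>" "is_partitioned L [x] y \<Delta>"
    and K: "\<And>\<phi> b. \<phi> \<in> \<Delta> \<Longrightarrow> b \<in> tuples M (length y) \<Longrightarrow>
      upper_set M lt (\<lambda>a. sat_at M (x # y) (a # b) \<phi>) (K \<phi>) = {}"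
  shows "has_uniform_definition L M 1 [x] y \<Delta>"
proof -
  have \<Delta>_fm: "is_formula_in L (x # y) \<phi>" if "\<phi> \<in> \<Delta>" for \<phi>
    using \<Delta>(2) that by (simp add: is_partitioned_def)
  obtain n where n: "\<And>v. v \<in> set (x # y) \<Longrightarrow> v < n"
    using finite_nat_set_iff_bounded[of "set (x # y)"] by auto
  \<comment> \<open>The variable \<open>n\<close> is reserved as the bound variable of the segment
    formulas, so the copy of \<open>y\<close> starts at \<open>Suc n\<close>.\<close>
  define y' where "y' = [Suc n..<Suc n + length y]"
  have len: "length y' = length y" unfolding y'_def length_upt by simp
  have dist: "distinct (x # n # y @ y')"
    using \<Delta>(2) n unfolding y'_def is_partitioned_def by (fastforce simp: less_Suc_eq)
  obtain idx where idx: "set idx = (SIGMA \<psi>:\<Delta>. {..K \<psi>})"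
    using finite_list[of "SIGMA \<psi>:\<Delta>. {..K \<psi>}"] \<Delta>(1) by auto
  \<comment> \<open>The extra index \<open>length idx\<close> serves points that lie in no segment;
    there every formula of \<Delta> fails.\<close>
  define F where "F i \<phi> = (if i < length idx
    then type_def_fm lt x n (zip y y') (idx ! i) \<phi> (K \<phi>) else Neg Truth)" for i \<phi>
  have F: "is_formula_in L (y @ y') (F i \<phi>)" if "\<phi> \<in> \<Delta>" for i \<phi>
  proof (cases "i < length idx")
    case True
    then have "fst (idx ! i) \<in> \<Delta>" using idx nth_mem[OF True] by auto
    then show ?thesis unfolding F_def
      using True is_formula_in_type_def_fm[OF dist len lt] \<Delta>_fm that by auto
  next
    case False
    then show ?thesis using dist by (simp add: F_def is_formula_in_def)
  qed
  have main: "\<exists>b'\<in>B. \<exists>i<Suc (length idx). \<forall>\<phi>\<in>\<Delta>. \<forall>b\<in>B.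
      sat_at M (x # y) (a # b) \<phi> \<longleftrightarrow> sat_at M (y @ y') (b @ b') (F i \<phi>)"
    if B: "finite B" "B \<noteq> {}" "B \<subseteq> tuples M (length y)" and a: "a \<in> univ M" for B a
  proof -
    define up where "up = (\<lambda>(\<phi>, j, b). upper_set M lt (\<lambda>a. sat_at M (x # y) (a # b) \<phi>) j)"
    have up_iff: "sat_at M (x # y) (a # b) \<phi> \<longleftrightarrow>
        (\<exists>j<K \<phi>. even j \<and> a \<in> up (\<phi>, j, b) \<and> a \<notin> up (\<phi>, Suc j, b))"
      if "\<phi> \<in> \<Delta>" "b \<in> B" for \<phi> b
      unfolding up_def prod.case using that B(3) by (intro iff_upper_set K a) auto
    define S where "S = {p \<in> (SIGMA \<phi>:\<Delta>. {..K \<phi>} \<times> B). a \<in> up p}"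
    show ?thesis
    proof (cases "S = {}")
      case True
      obtain b' where "b' \<in> B" using B(2) by blast
      moreover have "\<not> sat_at M (x # y) (a # b) \<phi>" if "\<phi> \<in> \<Delta>" "b \<in> B" for \<phi> b
        using up_iff[OF that] True that unfolding S_def by fastforce
      ultimately show ?thesis
        by (intro bexI[of _ b'] exI[of _ "length idx"]) (auto simp: F_def sat_at_def)
    next
      case False
      have "finite S" unfolding S_def using \<Delta>(1) B(1) by (intro finite_Collect_conjI disjI1 finite_SigmaI) auto
      then have "finite (up ` S)" "up ` S \<noteq> {}" using False by auto
      then obtain p where p: "p \<in> S" and min: "\<And>p'. p' \<in> S \<Longrightarrow> up p' \<subseteq> up p \<Longrightarrow> up p = up p'"
        using finite_has_minimal[of "up ` S"] by (metis imageE imageI)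
      obtain \<psi> i b' where p_eq: "p = (\<psi>, i, b')" by (cases p)
      have \<psi>: "\<psi> \<in> \<Delta>" "i \<le> K \<psi>" "b' \<in> B" "a \<in> up p" using p unfolding S_def p_eq by auto
      \<comment> \<open>Segments are linearly ordered, so a minimal one is least. Membership of
        \<open>a\<close> thus turns into inclusion, which is definable without
        \<open>a\<close>.\<close>
      have least: "a \<in> up (\<phi>, j, b) \<longleftrightarrow> up p \<subseteq> up (\<phi>, j, b)"
        if "\<phi> \<in> \<Delta>" "j \<le> K \<phi>" "b \<in> B" for \<phi> j b
      proof
        assume "a \<in> up (\<phi>, j, b)"
        then have "(\<phi>, j, b) \<in> S" using that by (auto simp: S_def)
        then show "up p \<subseteq> up (\<phi>, j, b)"
          using min[of "(\<phi>, j, b)"] upper_set_linear unfolding up_def p_eq prod.case by blast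
      qed (use \<psi>(4) in blast)
      have "(\<psi>, i) \<in> set idx" using idx \<psi> by auto
      then obtain k where k: "k < length idx" "idx ! k = (\<psi>, i)" by (auto simp: in_set_conv_nth)
      have "sat_at M (x # y) (a # b) \<phi> \<longleftrightarrow> sat_at M (y @ y') (b @ b') (F k \<phi>)"
        if \<phi>: "\<phi> \<in> \<Delta>" "b \<in> B" for \<phi> b
      proof -
        \<comment> \<open>The range \<open>j \<le> K \<phi>\<close> includes the successors of all
          \<open>j < K \<phi>\<close>, which also occur in \<open>type_def_fm\<close>.\<close>
        have incl: "sat M (assign (y @ y') (b @ b')) (incl_fm lt x n (zip y y') (\<psi>, i) \<phi> j) \<longleftrightarrow>
            a \<in> up (\<phi>, j, b)" if "j \<le> K \<phi>" for j
          using sat_incl_fm[OF dist len \<Delta>_fm[OF \<psi>(1)] \<Delta>_fm[OF \<phi>(1)], of b M b' lt i j]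
            B(3) \<phi> \<psi>(3) least[OF \<phi>(1) that \<phi>(2)]
          by (auto simp: up_def p_eq sat_at_def)
        have "sat_at M (y @ y') (b @ b') (F k \<phi>) \<longleftrightarrow>
            (\<exists>j<K \<phi>. even j \<and> a \<in> up (\<phi>, j, b) \<and> a \<notin> up (\<phi>, Suc j, b))"
          using k incl by (auto simp: F_def type_def_fm_def sat_at_def)
        then show ?thesis using up_iff[OF \<phi>] by simp
      qed
      then show ?thesis using k(1) \<psi>(3) by (intro bexI[of _ b'] exI[of _ k]) auto
    qed
  qed
  show ?thesis
    unfolding has_uniform_definition_def
  proof (intro exI[of _ "Suc (length idx)"] exI[of _ F] exI[of _ "[y']"] conjI allI impI)
    fix B q assume *: "finite B \<and> B \<noteq> {} \<and> B \<subseteq> tuples M (length y) \<and> q \<in> type_space M [x] y \<Delta> B"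
    then obtain as where as: "as \<in> tuples M 1" "q = tp M [x] y \<Delta> as B"
      by (auto simp: type_space_def)
    then obtain a where a: "a \<in> univ M" "q = tp M [x] y \<Delta> [a] B"
      by (auto simp: tuples_def length_Suc_conv)
    obtain b' i where "b' \<in> B" "i < Suc (length idx)" "\<forall>\<phi>\<in>\<Delta>. \<forall>b\<in>B.
      sat_at M (x # y) (a # b) \<phi> \<longleftrightarrow> sat_at M (y @ y') (b @ b') (F i \<phi>)"
      using main[of B a] * a(1) by auto
    then show "\<exists>bs i. length bs = 1 \<and> set bs \<subseteq> B \<and> i < Suc (length idx) \<and>
        (\<forall>\<phi>\<in>\<Delta>. \<forall>b\<in>B. (\<phi>, b) \<in> q \<longleftrightarrow>
          sat_at M (y @ concat [y']) (b @ concat bs) (F i \<phi>))"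
      by (intro exI[of _ "[b']"] exI[of _ i]) (auto simp: a(2) mem_tp_iff)
  qed (use dist len F in auto)
qed

text \<open>A point of the segment of index \<open>K\<close> would lie at or above the end of an
  alternating chain of index \<open>K\<close>, which uniform finiteness excludes; so this segment is
  empty for all parameters.\<close>

lemma weakly_o_minimal_VC1:
  fixes L :: "('f, 'r) language"
  assumes card: "{\<phi>::('f, 'r) fm. is_formula L \<phi>} \<lesssim> (UNIV :: 'm set)"
    and lt: "lt \<in> rels L" "rarity L lt = 2"
    and T: "\<forall>\<sigma>\<in>T. is_sentence L \<sigma>"
    and lin: "(models L T :: ('m, 'f, 'r) struct set) \<subseteq> models L (inf_lin_ord lt)"
    and wom: "weakly_o_minimal TYPE('m) L lt T"
  shows "VC_theory TYPE('m) L T 1"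
  unfolding VC_theory_def VC_struct_def
proof (intro ballI allI impI, elim conjE)
  fix M :: "('m, 'f, 'r) struct" and x y \<Delta>
  assume M: "M \<in> models L T" and \<Delta>: "is_partitioned L x y \<Delta>" "length x = 1" "finite \<Delta>"
  obtain v where x: "x = [v]" using \<Delta>(2) by (auto simp: length_Suc_conv)
  have "M \<in> models L (inf_lin_ord lt)" using M lin by blast
  then interpret linear_struct M lt
    unfolding models_inf_lin_ord by unfold_locales (elim conjE, blast)+
  have "\<exists>K. \<forall>b\<in>tuples M (length y). upper_set M lt (\<lambda>a. sat_at M (v # y) (a # b) \<phi>) K = {}"
    if "\<phi> \<in> \<Delta>" for \<phi>
  proof -
    have "is_formula_in L (v # y) \<phi>" using \<Delta>(1) that by (simp add: is_partitioned_def x)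
    from weakly_o_minimal_uniformly_finite[OF card lt T lin wom M this]
    obtain K where K: "\<forall>b\<in>tuples M (length y). \<not> (\<exists>c. (\<forall>i\<le>K. c i \<in> univ M) \<and>
      (\<forall>i<K. less_in M lt (c i) (c (Suc i))) \<and>
      (\<forall>i\<le>K. sat_at M (v # y) (c i # b) \<phi> \<longleftrightarrow> even i))" ..
    have "upper_set M lt (\<lambda>a. sat_at M (v # y) (a # b) \<phi>) K = {}" if b: "b \<in> tuples M (length y)" for b
    proof (rule ccontr)
      assume "upper_set M lt (\<lambda>a. sat_at M (v # y) (a # b) \<phi>) K \<noteq> {}"
      then obtain d where "d \<in> univ M" "alt_chain M lt (\<lambda>a. sat_at M (v # y) (a # b) \<phi>) K d"
        by (auto simp: upper_set_def)
      from alt_chain_imp_sequence[OF this(2,1)] K b show False by blast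
    qed
    then show ?thesis by blast
  qed
  then obtain K where "\<And>\<phi> b. \<phi> \<in> \<Delta> \<Longrightarrow> b \<in> tuples M (length y) \<Longrightarrow>
      upper_set M lt (\<lambda>a. sat_at M (v # y) (a # b) \<phi>) (K \<phi>) = {}"
    by metis
  then show "has_uniform_definition L M 1 x y \<Delta>"
    unfolding x by (rule has_uniform_definition_1[OF lt \<Delta>(3) \<Delta>(1)[unfolded x]])
qed

section \<open>Counting types\<close>

text \<open>The defining formula of a type over the tuples \<open>a @ b\<close> has a parameter of
  the form \<open>a @ b'\<close>. Its copy \<open>x'\<close> of \<open>x\<close> receives the same
  \<open>a\<close> and can be identified with \<open>x\<close>.\<close>

lemma sat_at_ren:
  assumes dist: "distinct (x @ y @ x' @ y')"
    and len: "length x' = length x" "length y' = length y"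
    and a: "a \<in> tuples M (length x)" and b: "length b = length y" "length b' = length y"
    and \<chi>: "is_formula_in L ((x @ y) @ x' @ y') \<chi>"
  shows "sat_at M (x @ y @ y') (a @ b @ b') (ren (zip x' x) \<chi>) \<longleftrightarrow>
    sat_at M ((x @ y) @ x' @ y') ((a @ b) @ a @ b') \<chi>"
proof -
  have la: "length a = length x" "set a \<subseteq> univ M" using a by (auto simp: tuples_def)
  define e where "e = assign (x @ y @ y') (a @ b @ b')"
  have "map e (x @ y @ y') = a @ b @ b'"
    unfolding e_def using dist len la b by (intro map_assign) auto
  then have e: "map e x = a" "map e y = b" "map e y' = b'"
    using la b len by auto
  let ?e = "\<lambda>w. case map_of (zip x' x) w of Some v \<Rightarrow> e v | None \<Rightarrow> e w"
  have zip: "fst ` set (zip x' x) = set x'" "snd ` set (zip x' x) = set x"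
    using len by (metis map_fst_zip set_map, metis map_snd_zip set_map)
  have "sat M e (ren (zip x' x) \<chi>) \<longleftrightarrow> sat M ?e \<chi>"
  proof (rule sat_ren)
    show "e v \<in> univ M" if "(u, v) \<in> set (zip x' x)" for u v
      using set_zip_rightD[OF that] e(1) la(2) by auto
  qed (use dist len zip in auto)
  moreover have "map ?e ((x @ y) @ x' @ y') = (a @ b) @ a @ b'"
  proof -
    have none: "?e w = e w" if "w \<notin> set x'" for w
      using that len by (simp add: map_of_zip_is_None[THEN iffD2])
    have "map ?e x = a" "map ?e y = b" "map ?e y' = b'"
      using dist none unfolding e[symmetric] by (auto simp: disjoint_iff simp del: option.case)
    moreover have "map ?e x' = a"
      using dist len la unfolding e(1)[symmetric]
      by (intro nth_equalityI) (auto simp: map_of_zip_nth)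
    ultimately show ?thesis by simp
  qed
  then have "sat_at M ((x @ y) @ x' @ y') ((a @ b) @ a @ b') \<chi> \<longleftrightarrow> sat M ?e \<chi>"
    using sat_at_map_eq_sat[OF \<chi>, of M ?e] by simp
  ultimately show ?thesis unfolding sat_at_def[of M "x @ y @ y'"] e_def by simp
qed

lemma tuples_append: "a \<in> tuples M m \<Longrightarrow> b \<in> tuples M n \<Longrightarrow> a @ b \<in> tuples M (m + n)"
  by (auto simp: tuples_def)

text \<open>The index \<open>i\<close> contributes a constant and \<open>b'\<close> a factor
  \<open>card B\<close>; the induction hypothesis counts the types of the remaining coordinates for
  the new formulas, which have more parameter variables. The empty \<open>B\<close> is excluded
  because it can have a type while \<open>0 ^ length x\<close> vanishes for nonempty
  \<open>x\<close>.\<close>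

lemma VC1_type_space_bound:
  fixes M :: "('m, 'f, 'r) struct"
  assumes VC: "VC_struct L M 1" and "finite \<Delta>" "is_partitioned L x y \<Delta>"
  shows "\<exists>C. \<forall>B. finite B \<longrightarrow> B \<noteq> {} \<longrightarrow> B \<subseteq> tuples M (length y) \<longrightarrow>
    finite (type_space M x y \<Delta> B) \<and> card (type_space M x y \<Delta> B) \<le> C * card B ^ length x"
  using assms(2,3)
proof (induction x arbitrary: y \<Delta>)
  case Nil
  have "type_space M [] y \<Delta> B = {tp M [] y \<Delta> [] B}" for B
    by (auto simp: type_space_def tuples_def)
  then show ?case by (intro exI[of _ 1]) simp
next
  case (Cons x0 x)
  show ?case
  \<comment> \<open>\<open>VC_struct\<close> speaks of nonempty \<Delta>; the empty one has at most
    one type.\<close>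
  proof (cases "\<Delta> = {}")
    case True
    have sub: "type_space M (x0 # x) y \<Delta> B \<subseteq> {{}}" for B
      by (auto simp: type_space_def tp_def True)
    show ?thesis
    proof (intro exI[of _ 1] allI impI conjI)
      fix B :: "'m list set" assume "finite B" "B \<noteq> {}"
      then have "1 \<le> card B ^ length (x0 # x)" by (simp add: Suc_le_eq card_gt_0_iff)
      moreover have "card (type_space M (x0 # x) y \<Delta> B) \<le> 1"
        using card_mono[OF _ sub[of B]] by simp
      ultimately show "card (type_space M (x0 # x) y \<Delta> B) \<le> 1 * card B ^ length (x0 # x)"
        by linarith
    qed (rule finite_subset[OF sub], simp)
  next
    case False
    have part: "is_partitioned L [x0] (x @ y) \<Delta>"
      using Cons.prems by (simp add: is_partitioned_def)
    then have "has_uniform_definition L M 1 [x0] (x @ y) \<Delta>"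
      using VC Cons.prems(1) False unfolding VC_struct_def by simp
    then obtain k :: nat and F zs where zs: "length zs = 1" "\<forall>z\<in>set zs. length z = length (x @ y)"
        "distinct ((x @ y) @ concat zs)"
      and F: "\<forall>i<k. \<forall>\<phi>\<in>\<Delta>. is_formula_in L ((x @ y) @ concat zs) (F i \<phi>)"
      and def: "\<forall>B q. finite B \<and> B \<noteq> {} \<and> B \<subseteq> tuples M (length (x @ y)) \<and>
          q \<in> type_space M [x0] (x @ y) \<Delta> B \<longrightarrow>
          (\<exists>bs i. length bs = 1 \<and> set bs \<subseteq> B \<and> i < k \<and>
            (\<forall>\<phi>\<in>\<Delta>. \<forall>b\<in>B. (\<phi>, b) \<in> q \<longleftrightarrow>
              sat_at M ((x @ y) @ concat zs) (b @ concat bs) (F i \<phi>)))"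
      unfolding has_uniform_definition_def by (elim exE conjE) (rule that)
    \<comment> \<open>The single parameter block is split into a copy of \<open>x\<close> and a copy
      of \<open>y\<close>.\<close>
    define x' where "x' = take (length x) (hd zs)"
    define y' where "y' = drop (length x) (hd zs)"
    have concat: "concat zs = x' @ y'" and len: "length x' = length x" "length y' = length y"
      using zs(1,2) by (auto simp: length_Suc_conv x'_def y'_def)
    have dist: "distinct (x @ y @ x' @ y')" using zs(3) by (simp add: concat)
    \<comment> \<open>After \<open>x'\<close> is identified with \<open>x\<close>, these are
      formulas in the object variables \<open>x\<close> with parameter variables
      \<open>y @ y'\<close>.\<close>
    define G where "G i \<phi> = ren (zip x' x) (F i \<phi>)" for i \<phi>
    have zip: "fst ` set (zip x' x) = set x'" "snd ` set (zip x' x) = set x"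
      using len by (metis map_fst_zip set_map, metis map_snd_zip set_map)
    have G: "is_partitioned L x (y @ y') (G i ` \<Delta>)" if "i < k" for i
    proof -
      have "is_formula_in L (x @ y @ y') (G i \<phi>)" if "\<phi> \<in> \<Delta>" for \<phi>
      proof -
        have "is_formula_in L ((x @ y) @ x' @ y') (F i \<phi>)"
          using F \<open>i < k\<close> that concat by simp
        moreover have "fv (G i \<phi>) \<subseteq> (fv (F i \<phi>) - set x') \<union> set x"
          using fv_ren[of "zip x' x" "F i \<phi>"] dist unfolding zip G_def by auto
        ultimately show ?thesis using dist by (auto simp: is_formula_in_def G_def)
      qed
      then show ?thesis using dist by (auto simp: is_partitioned_def)
    qed
    have "\<forall>i. \<exists>C. i < k \<longrightarrow> (\<forall>B. finite B \<longrightarrow> B \<noteq> {} \<longrightarrow> B \<subseteq> tuples M (length (y @ y')) \<longrightarrow>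
        finite (type_space M x (y @ y') (G i ` \<Delta>) B) \<and>
        card (type_space M x (y @ y') (G i ` \<Delta>) B) \<le> C * card B ^ length x)"
      using Cons.IH[OF _ G] Cons.prems(1) by blast
    then obtain C where C: "\<And>i B. i < k \<Longrightarrow> finite B \<Longrightarrow> B \<noteq> {} \<Longrightarrow> B \<subseteq> tuples M (length (y @ y')) \<Longrightarrow>
        finite (type_space M x (y @ y') (G i ` \<Delta>) B) \<and>
        card (type_space M x (y @ y') (G i ` \<Delta>) B) \<le> C i * card B ^ length x"
      by metis
    show ?thesis
    proof (intro exI[of _ "\<Sum>i<k. C i"] allI impI)
      fix B assume B: "finite B" "B \<noteq> {}" "B \<subseteq> tuples M (length y)"
      \<comment> \<open>Rebuilds the type of the whole tuple over \<open>B\<close> from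
        \<open>i\<close>, \<open>b'\<close> and the type \<open>p\<close> of the remaining
        coordinates over the tuples \<open>b @ b'\<close>.\<close>
      define \<Phi> where "\<Phi> i b' p =
          {(\<phi>, b) | \<phi> b. \<phi> \<in> \<Delta> \<and> b \<in> B \<and> (G i \<phi>, b @ b') \<in> p} \<union>
          {(Neg \<phi>, b) | \<phi> b. \<phi> \<in> \<Delta> \<and> b \<in> B \<and> (G i \<phi>, b @ b') \<notin> p}"
        for i b' and p :: "(('f, 'r) fm \<times> 'm list) set"
      define S where "S i b' = type_space M x (y @ y') (G i ` \<Delta>) ((\<lambda>b. b @ b') ` B)" for i b'
      have S: "finite (S i b') \<and> card (S i b') \<le> C i * card B ^ length x"
        if "i < k" "b' \<in> B" for i b'
      proof -
        have "(\<lambda>b. b @ b') ` B \<subseteq> tuples M (length (y @ y'))"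
          using B(3) that len by (auto intro!: tuples_append)
        then have "finite (S i b')"
          and "card (S i b') \<le> C i * card ((\<lambda>b. b @ b') ` B) ^ length x"
          using C[OF that(1), of "(\<lambda>b. b @ b') ` B"] B(1,2) unfolding S_def by auto
        moreover have "card ((\<lambda>b. b @ b') ` B) ^ length x \<le> card B ^ length x"
          using B(1) by (intro power_mono card_image_le) auto
        ultimately show ?thesis by (meson le_trans mult_le_mono2)
      qed
      have sub: "type_space M (x0 # x) y \<Delta> B \<subseteq> (\<Union>i<k. \<Union>b'\<in>B. \<Phi> i b' ` S i b')"
      proof
        fix q assume "q \<in> type_space M (x0 # x) y \<Delta> B"
        then obtain as where as: "as \<in> tuples M (length (x0 # x))" "q = tp M (x0 # x) y \<Delta> as B"
          by (auto simp: type_space_def)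
        then obtain a0 a where a: "as = a0 # a" "a0 \<in> univ M" "a \<in> tuples M (length x)"
          by (auto simp: tuples_def length_Suc_conv)
        let ?B = "(@) a ` B"
        have "?B \<subseteq> tuples M (length (x @ y))" using a(3) B(3) by (auto intro!: tuples_append)
        moreover have "tp M [x0] (x @ y) \<Delta> [a0] ?B \<in> type_space M [x0] (x @ y) \<Delta> ?B"
          using a(2) unfolding type_space_def tuples_def by fastforce
        ultimately obtain bs i where bs: "length bs = 1" "set bs \<subseteq> ?B" "i < k"
          and iff: "\<And>\<phi> b. \<phi> \<in> \<Delta> \<Longrightarrow> b \<in> ?B \<Longrightarrow> (\<phi>, b) \<in> tp M [x0] (x @ y) \<Delta> [a0] ?B \<longleftrightarrow>
              sat_at M ((x @ y) @ concat zs) (b @ concat bs) (F i \<phi>)"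
          using def[rule_format, of ?B "tp M [x0] (x @ y) \<Delta> [a0] ?B"] B(1,2) by blast
        \<comment> \<open>The parameter is chosen from \<open>?B\<close>, so its first part is
          \<open>a\<close> itself.\<close>
        obtain b' where b': "b' \<in> B" "concat bs = a @ b'"
          using bs(1,2) by (auto simp: length_Suc_conv)
        have *: "sat_at M ((x0 # x) @ y) (as @ b) \<phi> \<longleftrightarrow>
            (G i \<phi>, b @ b') \<in> tp M x (y @ y') (G i ` \<Delta>) a ((\<lambda>b. b @ b') ` B)"
          if "\<phi> \<in> \<Delta>" "b \<in> B" for \<phi> b
        proof -
          have "sat_at M ((x0 # x) @ y) (as @ b) \<phi> \<longleftrightarrow> (\<phi>, a @ b) \<in> tp M [x0] (x @ y) \<Delta> [a0] ?B"
            using that by (subst mem_tp_iff) (auto simp: a(1))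
          also have "\<dots> \<longleftrightarrow> sat_at M ((x @ y) @ x' @ y') ((a @ b) @ a @ b') (F i \<phi>)"
            using iff[of \<phi> "a @ b"] that by (simp add: b'(2) concat)
          also have "\<dots> \<longleftrightarrow> sat_at M (x @ y @ y') (a @ b @ b') (G i \<phi>)"
            unfolding G_def using F bs(3) that B(3) b'(1) concat
            by (intro sat_at_ren[symmetric, OF dist len a(3)]) (auto simp: tuples_def)
          also have "\<dots> \<longleftrightarrow> (G i \<phi>, b @ b') \<in> tp M x (y @ y') (G i ` \<Delta>) a ((\<lambda>b. b @ b') ` B)"
            using that by (subst mem_tp_iff) auto
          finally show ?thesis .
        qed
        have "q = \<Phi> i b' (tp M x (y @ y') (G i ` \<Delta>) a ((\<lambda>b. b @ b') ` B))"
          unfolding as(2) \<Phi>_def tp_def[of M "x0 # x"] using * by blast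
        moreover have "tp M x (y @ y') (G i ` \<Delta>) a ((\<lambda>b. b @ b') ` B) \<in> S i b'"
          using a(3) unfolding S_def type_space_def by blast
        ultimately show "q \<in> (\<Union>i<k. \<Union>b'\<in>B. \<Phi> i b' ` S i b')"
          using bs(3) b'(1) by blast
      qed
      have fin: "finite (\<Union>i<k. \<Union>b'\<in>B. \<Phi> i b' ` S i b')"
        using S B(1) by (intro finite_UN_I finite_imageI) auto
      have "card (type_space M (x0 # x) y \<Delta> B) \<le> card (\<Union>i<k. \<Union>b'\<in>B. \<Phi> i b' ` S i b')"
        by (rule card_mono[OF fin sub])
      also have "\<dots> \<le> (\<Sum>i<k. card (\<Union>b'\<in>B. \<Phi> i b' ` S i b'))"
        by (rule card_UN_le) simp
      also have "\<dots> \<le> (\<Sum>i<k. \<Sum>b'\<in>B. card (\<Phi> i b' ` S i b'))"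
        by (intro sum_mono card_UN_le B(1))
      also have "\<dots> \<le> (\<Sum>i<k. \<Sum>b'\<in>B. C i * card B ^ length x)"
      proof (intro sum_mono)
        fix i b' assume "i \<in> {..<k}" "b' \<in> B"
        then have "finite (S i b')" "card (S i b') \<le> C i * card B ^ length x" using S by auto
        then show "card (\<Phi> i b' ` S i b') \<le> C i * card B ^ length x"
          using card_image_le[of "S i b'" "\<Phi> i b'"] by linarith
      qed
      also have "\<dots> = (\<Sum>i<k. C i) * card B ^ length (x0 # x)"
        by (simp add: sum_distrib_left sum_distrib_right mult.left_commute)
      finally show "finite (type_space M (x0 # x) y \<Delta> B) \<and>
          card (type_space M (x0 # x) y \<Delta> B) \<le> (\<Sum>i<k. C i) * card B ^ length (x0 # x)"
        using finite_subset[OF sub fin] by blast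
    qed
  qed
qed

section \<open>The bound on the dual VC density\<close>

lemma VC1_dual_vc_density_le:
  fixes M :: "('m, 'f, 'r) struct"
  assumes "VC_struct L M 1" and "finite \<Delta>" "is_partitioned L x y \<Delta>"
  shows "dual_vc_density M x y \<Delta> \<le> ereal (real (length x))"
proof -
  obtain C where C: "\<And>B. finite B \<Longrightarrow> B \<noteq> {} \<Longrightarrow> B \<subseteq> tuples M (length y) \<Longrightarrow>
      card (type_space M x y \<Delta> B) \<le> C * card B ^ length x"
    using VC1_type_space_bound[OF assms] by blast
  \<comment> \<open>Positivity of \<open>t\<close> makes \<open>B\<close> nonempty; an asymptotic
    estimate may leave out \<open>t = 0\<close>.\<close>
  have le: "dual_shatter M x y \<Delta> t \<le> C * t ^ length x" if t: "t > 0" for t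
  proof -
    let ?S = "{card (type_space M x y \<Delta> B) | B.
      B \<subseteq> tuples M (length y) \<and> finite B \<and> card B = t}"
    have "n \<le> C * t ^ length x" if n: "n \<in> ?S" for n
    proof -
      obtain B where B: "n = card (type_space M x y \<Delta> B)" "B \<subseteq> tuples M (length y)" "finite B"
        "card B = t" using n by blast
      then have "B \<noteq> {}" using t by auto
      with C B show ?thesis by blast
    qed
    \<comment> \<open>If no \<open>B\<close> has \<open>t\<close> elements, this is the supremum of
      the empty set, which is 0.\<close>
    then have "Sup ?S \<le> C * t ^ length x"
      using cSup_least[of ?S] by (cases "?S = {}") (simp only: Sup_nat_empty le0, blast)
    then show ?thesis unfolding dual_shatter_def .
  qed
  have "(\<lambda>t. real (dual_shatter M x y \<Delta> t)) \<in> O(\<lambda>t. real t powr real (length x))"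
  proof (intro bigoI[where c = "real C"] eventually_mono[OF eventually_gt_at_top[of 0]])
    fix t :: nat assume t: "t > 0"
    have "real (dual_shatter M x y \<Delta> t) \<le> real (C * t ^ length x)"
      using le[OF t] of_nat_le_iff by blast
    with t show "norm (real (dual_shatter M x y \<Delta> t)) \<le> real C * norm (real t powr real (length x))"
      by (simp add: powr_realpow)
  qed
  then show ?thesis
    unfolding dual_vc_density_def by (intro Inf_lower) auto
qed

theorem theorem6p1:
  fixes L :: "('f, 'r) language" and T :: "('f, 'r) fm set" and lt :: 'r
  assumes "{\<phi>. is_formula L \<phi>} \<lesssim> (UNIV :: 'm set)"
    and "lt \<in> rels L" and "rarity L lt = 2"
    and "\<forall>\<sigma>\<in>T. is_sentence L \<sigma>"
    and "(models L T :: ('m, 'f, 'r) struct set) \<subseteq> models L (inf_lin_ord lt)"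
    and "weakly_o_minimal TYPE('m) L lt T"
  shows "VC_theory TYPE('m) L T 1 \<and>
    (\<forall>M \<in> (models L T :: ('m, 'f, 'r) struct set). \<forall>x y \<Delta>.
       finite \<Delta> \<and> is_partitioned L x y \<Delta> \<longrightarrow>
       dual_vc_density M x y \<Delta> \<le> ereal (real (length x)))"
proof -
  have "VC_theory TYPE('m) L T 1" by (rule weakly_o_minimal_VC1[OF assms])
  then show ?thesis using VC1_dual_vc_density_le unfolding VC_theory_def by blast
qed

end
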